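(* Let $(X,\delta)$ be an ultrahomogeneous, universal Polish diversity. Then $(X,\delta)$ has the extension property, and is thus isomorphic to the diversity $(\mathbb{U},\delta_{\mathbb{U}})$ constructed in the context.
   Context: Write $\mathcal{P}_{\mathrm{fin}}(X)$ for the set of finite subsets of $X$. A diversity is a pair $(X,\delta)$ with $X$ a set and $\delta:\mathcal{P}_{\mathrm{fin}}(X)\to\mathbb{R}$ such that for all finite $A,B,C\subseteq X$: (D1) $\delta(A)\ge 0$, and $\delta(A)=0$ if and only if $|A|\le 1$; (D2) if $B\ne\emptyset$ then $\delta(A\cup B)+\delta(B\cup C)\ge\delta(A\cup C)$. The induced metric is $d(a,b)=\delta(\{a,b\})$. A diversity is separable (complete, Polish) if its induced metric space is separable (complete, separable and complete). A subset of $X$ is a diversity under the restriction of $\delta$. An isomorphism from $(X,\delta_X)$ onto $(Y,\delta_Y)$ is a bijection $\phi$ with $\delta_Y(\phi(A))=\delta_X(A)$ for all finite $A\subseteq X$. A Polish diversity is universal if every separable diversity is isomorphic to a subset of it. A Polish diversity $(X,\delta)$ is ultrahomogeneous if for any two finite subsets $A,A'\subseteq X$ and any isomorphism $\phi:A\to A'$ there is an isomorphism of $(X,\delta)$ onto itself extending $\phi$. Admissible functions: $f:\mathcal{P}_{\mathrm{fin}}(X)\to\mathbb{R}$ is admissible on $(X,\delta)$ if for some point $z$ (possibly in $X$) there is a diversity $(X\cup\{z\},\delta')$ with $\delta'(A)=\delta(A)$ and $\delta'(A\cup\{z\})=f(A)$ for all finite $A\subseteq X$. $E(X)$ is the set of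 admissible functions on $(X,\delta)$. A diversity $(X,\delta)$ has the extension property if for any finite $F\subseteq X$ and any $f\in E(F)$ there is $x\in X$ with $f(A)=\delta(A\cup\{x\})$ for all $A\subseteq F$. $E(X)$ carries the diversity $\widehat\delta$ with $\widehat\delta(\emptyset)=\widehat\delta(\{f\})=0$ and, for distinct $f_1,\dots,f_k$, $k\ge 2$, $$\widehat\delta(\{f_1,\ldots,f_k\})=\max_{1\le j\le k}\ \sup_{A_1,\ldots,A_k}\Big\{f_j\big(\bigcup_{i\ne j}A_i\big)-\sum_{i\ne j}f_i(A_i)\Big\},$$ the $A_i$ ranging over finite subsets of $X$. $(X,\delta)$ embeds in $(E(X),\widehat\delta)$ via $x\mapsto\kappa_x$, $\kappa_x(A)=\delta(A\cup\{x\})$. Finite support: for nonempty $S\subseteq X$ and $f\in E(S)$ ($S$ with the restricted diversity), let $$f_S^X(A)=\inf\Big\{f(B)+\sum_{b\in B}\delta(A_b\cup\{b\}) : B\subseteq S\text{ finite},\ \bigcup_{b\in B}A_b=A\Big\}$$ for finite $A\subseteq X$. A function $g\in E(X)$ is finitely supported if $g=f_S^X$ for some finite nonempty $S\subseteq X$ and $f\in E(S)$. $E(X,\omega)$ is the set of finitely supported elements of $E(X)$, with the diversity $\widehat\delta$; it contains all $\kappa_x$. Construction: given $(X,\delta)$, put $(X_0,\delta_0)=(X,\delta)$ and $X_n=E(X_{n-1},\omega)$, $\delta_n=\widehat{\delta_{n-1}}$ for $n\ge 1$. Identifying $X_{n-1}$ with its image in $X_n$ under $x\mapsto\kappa_x$,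 let $(X_\omega,\delta_\omega)$ be the union (direct limit) of the $(X_n,\delta_n)$. The completion of a diversity is the completion of its induced metric space, with the diversity function extended by continuity (i.e. so that $(a_1,\dots,a_k)\mapsto\delta(\{a_1,\dots,a_k\})$ is continuous for each $k$). $(\mathbb{U},\delta_{\mathbb{U}})$ is the completion of $(X_\omega,\delta_\omega)$ when $(X,\delta)$ is the diversity on a single point. *)

theory Defs
  imports "HOL-Analysis.Analysis"
begin

section \<open>Diversities\<close>

text \<open>
  A diversity consists of a carrier \<open>X\<close> and a function \<open>\<delta>\<close> of which only the values on
  \<open>Fpow X\<close>, the set of finite subsets of \<open>X\<close>, are relevant. A subset \<open>Y\<close> of \<open>X\<close> with the
  restricted diversity is thus given by \<open>Y\<close> and the same \<open>\<delta>\<close>.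
\<close>

locale diversity =
  fixes X :: "'a set" and \<delta> :: "'a set \<Rightarrow> real"
  assumes nonneg: "A \<in> Fpow X \<Longrightarrow> 0 \<le> \<delta> A"
    and zero_iff: "A \<in> Fpow X \<Longrightarrow> \<delta> A = 0 \<longleftrightarrow> card A \<le> 1"
    and triangle: "\<lbrakk>A \<in> Fpow X; B \<in> Fpow X; C \<in> Fpow X; B \<noteq> {}\<rbrakk>
                   \<Longrightarrow> \<delta> (A \<union> C) \<le> \<delta> (A \<union> B) + \<delta> (B \<union> C)"

text \<open>
  The value \<open>0\<close> off the carrier is needed because the locale \<^locale>\<open>Metric_space\<close> requires
  nonnegativity for all arguments.
\<close>

definition induced_metric :: "'a set \<Rightarrow> ('a set \<Rightarrow> real) \<Rightarrow> 'a \<Rightarrow> 'a \<Rightarrow> real" where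
  "induced_metric X \<delta> a b = (if a \<in> X \<and> b \<in> X then \<delta> {a, b} else 0)"

definition separable_diversity :: "'a set \<Rightarrow> ('a set \<Rightarrow> real) \<Rightarrow> bool" where
  "separable_diversity X \<delta> \<longleftrightarrow>
     diversity X \<delta> \<and> separable_space (Metric_space.mtopology X (induced_metric X \<delta>))"

definition complete_diversity :: "'a set \<Rightarrow> ('a set \<Rightarrow> real) \<Rightarrow> bool" where
  "complete_diversity X \<delta> \<longleftrightarrow>
     diversity X \<delta> \<and> Metric_space.mcomplete X (induced_metric X \<delta>)"

definition polish_diversity :: "'a set \<Rightarrow> ('a set \<Rightarrow> real) \<Rightarrow> bool" where
  "polish_diversity X \<delta> \<longleftrightarrow> separable_diversity X \<delta> \<and> complete_diversity X \<delta>"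

definition diversity_iso ::
  "'a set \<Rightarrow> ('a set \<Rightarrow> real) \<Rightarrow> 'b set \<Rightarrow> ('b set \<Rightarrow> real) \<Rightarrow> ('a \<Rightarrow> 'b) \<Rightarrow> bool" where
  "diversity_iso X \<delta>X Y \<delta>Y \<phi> \<longleftrightarrow>
     bij_betw \<phi> X Y \<and> (\<forall>A \<in> Fpow X. \<delta>Y (\<phi> ` A) = \<delta>X A)"

definition isomorphic_diversities ::
  "'a set \<Rightarrow> ('a set \<Rightarrow> real) \<Rightarrow> 'b set \<Rightarrow> ('b set \<Rightarrow> real) \<Rightarrow> bool" where
  "isomorphic_diversities X \<delta>X Y \<delta>Y \<longleftrightarrow> (\<exists>\<phi>. diversity_iso X \<delta>X Y \<delta>Y \<phi>)"

text \<open>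
  A formula cannot quantify over all types. Since separable metric spaces have at most the
  cardinality of the continuum, it suffices to let the separable diversities range over those
  whose points are real numbers; lemma \<open>universal_diversity_any_type\<close> below recovers the
  property for separable diversities over an arbitrary type.
\<close>

definition universal_diversity :: "'a set \<Rightarrow> ('a set \<Rightarrow> real) \<Rightarrow> bool" where
  "universal_diversity X \<delta> \<longleftrightarrow> polish_diversity X \<delta> \<and>
     (\<forall>(Y :: real set) \<delta>Y. separable_diversity Y \<delta>Y \<longrightarrow>
        (\<exists>Z \<subseteq> X. isomorphic_diversities Y \<delta>Y Z \<delta>))"

definition ultrahomogeneous_diversity :: "'a set \<Rightarrow> ('a set \<Rightarrow> real) \<Rightarrow> bool" where
  "ultrahomogeneous_diversity X \<delta> \<longleftrightarrow> polish_diversity X \<delta> \<and>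
     (\<forall>A \<in> Fpow X. \<forall>A' \<in> Fpow X. \<forall>\<phi>. diversity_iso A \<delta> A' \<delta> \<phi> \<longrightarrow>
        (\<exists>\<psi>. diversity_iso X \<delta> X \<delta> \<psi> \<and> (\<forall>a \<in> A. \<psi> a = \<phi> a)))"


section \<open>Admissible functions\<close>

text \<open>
  Functions on \<open>Fpow X\<close> are represented by \<^const>\<open>extensional\<close> functions, so that equality of
  elements of \<open>E(X)\<close> is equality in HOL. The one-point extension lives on \<^typ>\<open>'a option\<close>
  (with \<open>X\<close> identified with \<open>Some ` X\<close>), so that a point outside \<open>X\<close> is always available.
\<close>

definition adm_fun :: "'a set \<Rightarrow> ('a set \<Rightarrow> real) \<Rightarrow> ('a set \<Rightarrow> real) \<Rightarrow> bool" where
  "adm_fun X \<delta> f \<longleftrightarrow>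
     (\<exists>(z :: 'a option) \<delta>'. diversity (insert z (Some ` X)) \<delta>' \<and>
        (\<forall>A \<in> Fpow X. \<delta>' (Some ` A) = \<delta> A \<and> \<delta>' (insert z (Some ` A)) = f A))"

definition adm_space :: "'a set \<Rightarrow> ('a set \<Rightarrow> real) \<Rightarrow> ('a set \<Rightarrow> real) set" where
  "adm_space X \<delta> = {f \<in> extensional (Fpow X). adm_fun X \<delta> f}"

definition extension_property :: "'a set \<Rightarrow> ('a set \<Rightarrow> real) \<Rightarrow> bool" where
  "extension_property X \<delta> \<longleftrightarrow>
     (\<forall>F \<in> Fpow X. \<forall>f \<in> adm_space F \<delta>. \<exists>x \<in> X. \<forall>A \<subseteq> F. f A = \<delta> (insert x A))"

definition kappa :: "'a set \<Rightarrow> ('a set \<Rightarrow> real) \<Rightarrow> 'a \<Rightarrow> 'a set \<Rightarrow> real" where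
  "kappa X \<delta> x = restrict (\<lambda>A. \<delta> (insert x A)) (Fpow X)"

text \<open>
  The family \<open>A\<^sub>1, \<dots>, A\<^sub>k\<close> belonging to distinct \<open>f\<^sub>1, \<dots>, f\<^sub>k\<close> is indexed by the functions
  themselves.
\<close>

definition delta_hat :: "'a set \<Rightarrow> ('a set \<Rightarrow> real) set \<Rightarrow> real" where
  "delta_hat X \<F> =
     (if card \<F> \<le> 1 then 0
      else MAX f \<in> \<F>. SUP A \<in> \<F> \<rightarrow> Fpow X.
             f (\<Union>g \<in> \<F> - {f}. A g) - (\<Sum>g \<in> \<F> - {f}. g (A g)))"

definition supp_extension ::
  "'a set \<Rightarrow> ('a set \<Rightarrow> real) \<Rightarrow> 'a set \<Rightarrow> ('a set \<Rightarrow> real) \<Rightarrow> 'a set \<Rightarrow> real" where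
  "supp_extension X \<delta> S f =
     restrict (\<lambda>A. Inf {f B + (\<Sum>b \<in> B. \<delta> (insert b (C b))) | B C.
                          B \<in> Fpow S \<and> (\<Union>b \<in> B. C b) = A}) (Fpow X)"

definition finsupp_space :: "'a set \<Rightarrow> ('a set \<Rightarrow> real) \<Rightarrow> ('a set \<Rightarrow> real) set" where
  "finsupp_space X \<delta> =
     {g \<in> adm_space X \<delta>. \<exists>S \<in> Fpow X. S \<noteq> {} \<and>
        (\<exists>f \<in> adm_space S \<delta>. g = supp_extension X \<delta> S f)}"


section \<open>The iterated extension of a one-point diversity\<close>

text \<open>
  The function spaces \<open>E(X, \<omega>)\<close>, \<open>E(E(X, \<omega>), \<omega>)\<close>, \dots have different types. To take the union,
  they are copied into the type \<^typ>\<open>nat \<times> real\<close>: \<open>\<kappa>\<^sub>x\<close> is represented by \<open>x\<close> itself, and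
  the other functions of stage \<open>n + 1\<close> by pairs with first component \<open>n + 1\<close>, by means of
  an injection into the reals. Such an injection exists (\<open>finsupp_space_inj_real\<close>), hence
  \<open>tower_code\<close> is injective (\<open>inj_on_tower_code\<close>).
\<close>

type_synonym tower_point = "nat \<times> real"

definition tower_code ::
  "nat \<Rightarrow> tower_point set \<Rightarrow> (tower_point set \<Rightarrow> real) \<Rightarrow> (tower_point set \<Rightarrow> real) \<Rightarrow> tower_point" where
  "tower_code n X \<delta> g =
     (if g \<in> kappa X \<delta> ` X then inv_into X (kappa X \<delta>) g
      else (Suc n, (SOME e :: _ \<Rightarrow> real. inj_on e (finsupp_space X \<delta>)) g))"

definition tower_step ::
  "nat \<Rightarrow> tower_point set \<times> (tower_point set \<Rightarrow> real) \<Rightarrow> tower_point set \<times> (tower_point set \<Rightarrow> real)" where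
  "tower_step n = (\<lambda>(X, \<delta>).
     (tower_code n X \<delta> ` finsupp_space X \<delta>,
      \<lambda>A. delta_hat X (inv_into (finsupp_space X \<delta>) (tower_code n X \<delta>) ` A)))"

primrec tower :: "nat \<Rightarrow> tower_point set \<times> (tower_point set \<Rightarrow> real)" where
  "tower 0 = ({(0, 0)}, \<lambda>A. 0)"
| "tower (Suc n) = tower_step n (tower n)"

definition tower_union :: "tower_point set" where
  "tower_union = (\<Union>n. fst (tower n))"

text \<open>A finite subset of the union is measured at the first stage containing it.\<close>

definition tower_union_delta :: "tower_point set \<Rightarrow> real" where
  "tower_union_delta A = snd (tower (LEAST n. A \<subseteq> fst (tower n))) A"


section \<open>Completion\<close>

text \<open>
  The points of the completion are the equivalence classes of Cauchy sequences. The continuous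
  extension of \<open>\<delta>\<close> to a finite set of classes is the limit of \<open>\<delta>\<close> along representatives.
\<close>

definition cauchy_rel :: "'a set \<Rightarrow> ('a set \<Rightarrow> real) \<Rightarrow> ((nat \<Rightarrow> 'a) \<times> (nat \<Rightarrow> 'a)) set" where
  "cauchy_rel X \<delta> =
     {(s, t). Metric_space.MCauchy X (induced_metric X \<delta>) s \<and>
              Metric_space.MCauchy X (induced_metric X \<delta>) t \<and>
              (\<lambda>n. induced_metric X \<delta> (s n) (t n)) \<longlonglongrightarrow> 0}"

definition completion_carrier :: "'a set \<Rightarrow> ('a set \<Rightarrow> real) \<Rightarrow> (nat \<Rightarrow> 'a) set set" where
  "completion_carrier X \<delta> =
     {s. Metric_space.MCauchy X (induced_metric X \<delta>) s} // cauchy_rel X \<delta>"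

definition completion_delta :: "('a set \<Rightarrow> real) \<Rightarrow> (nat \<Rightarrow> 'a) set set \<Rightarrow> real" where
  "completion_delta \<delta> \<C> = lim (\<lambda>n. \<delta> ((\<lambda>C. (SOME s. s \<in> C) n) ` \<C>))"

definition UU :: "(nat \<Rightarrow> tower_point) set set" where
  "UU = completion_carrier tower_union tower_union_delta"

definition delta_UU :: "(nat \<Rightarrow> tower_point) set set \<Rightarrow> real" where
  "delta_UU = completion_delta tower_union_delta"


section \<open>Adequacy of the encodings\<close>

lemma (in diversity) Metric_space: "Metric_space X (induced_metric X \<delta>)"
proof
  fix x y z
  show "0 \<le> induced_metric X \<delta> x y"
    by (auto simp: induced_metric_def Fpow_def intro!: nonneg)
  show "induced_metric X \<delta> x y = induced_metric X \<delta> y x"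
    by (auto simp: induced_metric_def insert_commute)
  show "induced_metric X \<delta> x y = 0 \<longleftrightarrow> x = y" if "x \<in> X" "y \<in> X"
    using that zero_iff[of "{x, y}"] by (auto simp: induced_metric_def Fpow_def card_insert_if)
  show "induced_metric X \<delta> x z \<le> induced_metric X \<delta> x y + induced_metric X \<delta> y z"
    if "x \<in> X" "y \<in> X" "z \<in> X"
    using that triangle[of "{x}" "{y}" "{z}"]
    by (simp add: induced_metric_def Fpow_def insert_commute)
qed

lemma nat_rel_inj_real: "\<exists>h :: (nat \<times> nat) set \<Rightarrow> real. inj h"
proof -
  have "(UNIV :: nat set set) \<lesssim> (UNIV :: real set)"
    using nat_sets_eqpoll_reals eqpoll_imp_lepoll by blast
  then obtain h :: "nat set \<Rightarrow> real" where h: "inj h"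
    by (auto simp: lepoll_def)
  have "inj (h \<circ> image prod_encode)"
    by (intro inj_compose h injI) (simp add: inj_image_eq_iff[OF inj_prod_encode])
  then show ?thesis by blast
qed

lemma real_list_inj_real: "\<exists>h :: real list \<Rightarrow> real. inj h"
proof -
  obtain h :: "(nat \<times> nat) set \<Rightarrow> real" where h: "inj h"
    using nat_rel_inj_real by blast
  have "(UNIV :: real set) \<lesssim> (UNIV :: nat set set)"
    using nat_sets_eqpoll_reals eqpoll_imp_lepoll eqpoll_sym by blast
  then obtain k :: "real \<Rightarrow> nat set" where k: "inj k"
    by (auto simp: lepoll_def)
  define E :: "real list \<Rightarrow> (nat \<times> nat) set" where
    "E xs = {(i, j). i < length xs \<and> (j = 0 \<or> j - 1 \<in> k (xs ! i))}" for xs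
  have "inj E"
  proof (rule injI)
    fix xs ys assume eq: "E xs = E ys"
    have len: "i < length xs \<longleftrightarrow> i < length ys" for i
    proof -
      have "(i, 0) \<in> E xs \<longleftrightarrow> (i, 0) \<in> E ys" by (simp only: eq)
      then show ?thesis by (simp add: E_def)
    qed
    then have l: "length xs = length ys"
      by (metis linorder_neqE_nat less_irrefl)
    show "xs = ys"
    proof (rule nth_equalityI[OF l])
      fix i assume i: "i < length xs"
      have "m \<in> k (xs ! i) \<longleftrightarrow> m \<in> k (ys ! i)" for m
      proof -
        have "(i, Suc m) \<in> E xs \<longleftrightarrow> (i, Suc m) \<in> E ys" by (simp only: eq)
        then show ?thesis using i l by (simp add: E_def)
      qed
      then show "xs ! i = ys ! i" using k by (auto dest: injD)
    qed
  qed
  then have "inj (h \<circ> E)"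
    using h by (rule inj_compose[rotated])
  then show ?thesis by blast
qed

lemma finsupp_space_inj_real:
  fixes X :: "tower_point set"
  shows "\<exists>e :: _ \<Rightarrow> real. inj_on e (finsupp_space X \<delta>)"
proof -
  obtain h :: "real list \<Rightarrow> real" where h: "inj h"
    using real_list_inj_real by blast
  have "\<exists>xs f. f \<in> adm_space (set xs) \<delta> \<and> g = supp_extension X \<delta> (set xs) f"
    if "g \<in> finsupp_space X \<delta>" for g
    using that unfolding finsupp_space_def Fpow_def by (smt (verit) finite_list mem_Collect_eq)
  then obtain xs f where xsf: "\<And>g. g \<in> finsupp_space X \<delta> \<Longrightarrow>
      f g \<in> adm_space (set (xs g)) \<delta> \<and> g = supp_extension X \<delta> (set (xs g)) (f g)"
    by metis
  define c where "c g = real (length (xs g)) # map (real \<circ> fst) (xs g) @ map snd (xs g) @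
                        map (f g \<circ> set) (subseqs (xs g))" for g
  have "inj_on c (finsupp_space X \<delta>)"
  proof (rule inj_onI)
    fix g g' assume g: "g \<in> finsupp_space X \<delta>" "g' \<in> finsupp_space X \<delta>" and eq: "c g = c g'"
    have l: "length (xs g) = length (xs g')"
      using eq by (simp add: c_def)
    have m: "map (real \<circ> fst) (xs g) = map (real \<circ> fst) (xs g')" "map snd (xs g) = map snd (xs g')"
      and v: "map (f g \<circ> set) (subseqs (xs g)) = map (f g' \<circ> set) (subseqs (xs g'))"
      using eq l by (simp_all add: c_def)
    have xs: "xs g = xs g'"
    proof (rule nth_equalityI[OF l])
      fix i assume "i < length (xs g)"
      then show "xs g ! i = xs g' ! i"
        using m l by (auto simp: list_eq_iff_nth_eq prod_eq_iff)
    qed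
    have "f g B = f g' B" for B
    proof (cases "B \<subseteq> set (xs g)")
      case True
      then have "B \<in> set ` set (subseqs (xs g))"
        by (simp add: subseqs_powset)
      then show ?thesis using v xs by auto
    next
      case False
      then show ?thesis
        using xsf[OF g(1)] xsf[OF g(2)] xs
        by (auto simp: adm_space_def extensional_def Fpow_def)
    qed
    then have "f g = f g'" by blast
    then show "g = g'" using xsf[OF g(1)] xsf[OF g(2)] xs by metis
  qed
  then have "inj_on (h \<circ> c) (finsupp_space X \<delta>)"
    using h by (meson comp_inj_on inj_on_subset subset_UNIV)
  then show ?thesis by blast
qed

lemma tower_levels: "fst (tower n) \<subseteq> {..n} \<times> UNIV"
proof (induction n)
  case (Suc n)
  obtain X \<delta> where t: "tower n = (X, \<delta>)" by force
  have "tower_code n X \<delta> g \<in> {..Suc n} \<times> UNIV" for g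
  proof (cases "g \<in> kappa X \<delta> ` X")
    case True
    then have "tower_code n X \<delta> g \<in> X"
      by (simp add: tower_code_def inv_into_into)
    then show ?thesis using Suc t by auto
  qed (simp add: tower_code_def)
  then show ?case
    unfolding tower.simps tower_step_def t prod.case fst_conv by blast
qed simp

lemma inj_on_tower_code:
  assumes "tower n = (X, \<delta>)"
  shows "inj_on (tower_code n X \<delta>) (finsupp_space X \<delta>)"
proof (rule inj_onI)
  fix g g' assume g: "g \<in> finsupp_space X \<delta>" "g' \<in> finsupp_space X \<delta>"
    and eq: "tower_code n X \<delta> g = tower_code n X \<delta> g'"
  have X: "X \<subseteq> {..n} \<times> UNIV"
    using tower_levels[of n] assms by simp
  have *: "fst (tower_code n X \<delta> g) \<le> n \<longleftrightarrow> g \<in> kappa X \<delta> ` X" for g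
  proof
    assume "g \<in> kappa X \<delta> ` X"
    then have "tower_code n X \<delta> g \<in> X"
      by (simp add: tower_code_def inv_into_into)
    then show "fst (tower_code n X \<delta> g) \<le> n" using X by auto
  qed (auto simp: tower_code_def split: if_splits)
  have e: "inj_on (SOME e :: _ \<Rightarrow> real. inj_on e (finsupp_space X \<delta>)) (finsupp_space X \<delta>)"
    using finsupp_space_inj_real by (rule someI_ex)
  show "g = g'"
  proof (cases "g \<in> kappa X \<delta> ` X")
    case True
    then have "g' \<in> kappa X \<delta> ` X" using * eq by metis
    with True eq show ?thesis
      by (simp add: tower_code_def) (metis f_inv_into_f)
  next
    case False
    then have "g' \<notin> kappa X \<delta> ` X" using * eq by metis
    with False eq have "(SOME e :: _ \<Rightarrow> real. inj_on e (finsupp_space X \<delta>)) g =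
        (SOME e :: _ \<Rightarrow> real. inj_on e (finsupp_space X \<delta>)) g'"
      by (simp add: tower_code_def)
    then show ?thesis by (rule inj_onD[OF e _ g])
  qed
qed

lemma kappa_inj_on:
  assumes "diversity X \<delta>"
  shows "inj_on (kappa X \<delta>) X"
proof (rule inj_onI)
  interpret diversity X \<delta> by fact
  fix x y assume xy: "x \<in> X" "y \<in> X" "kappa X \<delta> x = kappa X \<delta> y"
  from fun_cong[OF xy(3), of "{x}"] have "\<delta> {y, x} = \<delta> {x}"
    using xy by (simp add: kappa_def Fpow_def)
  then have "\<delta> {y, x} = 0"
    using xy zero_iff[of "{x}"] by (auto simp: Fpow_def)
  then show "x = y"
    using xy zero_iff[of "{y, x}"] by (auto simp: Fpow_def card_insert_if split: if_splits)
qed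

lemma tower_code_kappa:
  assumes "diversity X \<delta>" "x \<in> X"
  shows "tower_code n X \<delta> (kappa X \<delta> x) = x"
  using assms by (simp add: tower_code_def kappa_inj_on inv_into_f_f)

lemma separable_diversity_inj_real:
  fixes Y :: "'b set"
  assumes "separable_diversity Y \<delta>"
  shows "\<exists>j :: 'b \<Rightarrow> real. inj_on j Y"
proof -
  interpret diversity Y \<delta> using assms by (simp add: separable_diversity_def)
  interpret M: Metric_space Y "induced_metric Y \<delta>" by (rule Metric_space)
  let ?d = "induced_metric Y \<delta>"
  obtain h :: "(nat \<times> nat) set \<Rightarrow> real" where h: "inj h"
    using nat_rel_inj_real by blast
  obtain C where C: "countable C" "C \<subseteq> Y" "M.mtopology closure_of C = Y"
    using assms by (auto simp: separable_diversity_def separable_space_def)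
  define E where "E y = {(i, m). i \<in> to_nat_on C ` C \<and>
                     ?d y (from_nat_into C i) < inverse (real (Suc m))}" for y
  have "inj_on E Y"
  proof (rule inj_onI, rule ccontr)
    fix y y' assume y: "y \<in> Y" "y' \<in> Y" "E y = E y'" "y \<noteq> y'"
    then have "?d y y' / 2 > 0" by simp
    then obtain m where m: "inverse (real (Suc m)) < ?d y y' / 2"
      using reals_Archimedean by blast
    have "y \<in> M.mtopology closure_of C" using C y by simp
    then obtain c where c: "c \<in> C" "?d y c < inverse (real (Suc m))"
      unfolding M.metric_closure_of M.in_mball
      by (smt (verit) inverse_positive_iff_positive mem_Collect_eq of_nat_0_less_iff zero_less_Suc)
    then have "(to_nat_on C c, m) \<in> E y" using C by (simp add: E_def)
    then have "(to_nat_on C c, m) \<in> E y'" using y by simp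
    then have "?d y' c < inverse (real (Suc m))" using C c by (simp add: E_def)
    moreover have "?d y y' \<le> ?d y c + ?d c y'" using y C c by (intro M.triangle) auto
    ultimately show False using c m M.commute[of c y'] by linarith
  qed
  then have "inj_on (h \<circ> E) Y"
    using h by (meson comp_inj_on inj_on_subset subset_UNIV)
  then show ?thesis by blast
qed

lemma separable_diversity_iso:
  assumes Y: "separable_diversity Y \<delta>Y" and iso: "diversity_iso Y \<delta>Y Z \<delta>Z j"
  shows "separable_diversity Z \<delta>Z"
proof -
  interpret Y: diversity Y \<delta>Y using Y by (simp add: separable_diversity_def)
  have j: "inj_on j Y" "j ` Y = Z" and d: "\<And>A. A \<in> Fpow Y \<Longrightarrow> \<delta>Z (j ` A) = \<delta>Y A"
    using iso by (auto simp: diversity_iso_def bij_betw_def)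
  have pre: "\<exists>A. A \<in> Fpow Y \<and> j ` A = B" if "B \<in> Fpow Z" for B
    using that finite_subset_image[of B j Y] j(2) unfolding Fpow_def by blast
  have Z: "diversity Z \<delta>Z"
  proof
    fix B assume "B \<in> Fpow Z"
    then obtain A where A: "A \<in> Fpow Y" "B = j ` A" using pre by blast
    then have "card B = card A"
      using card_image[OF inj_on_subset[OF j(1), of A]] by (simp add: Fpow_def)
    then show "0 \<le> \<delta>Z B" "\<delta>Z B = 0 \<longleftrightarrow> card B \<le> 1"
      using A d Y.nonneg Y.zero_iff by simp_all
  next
    fix A' B' C' assume "A' \<in> Fpow Z" "B' \<in> Fpow Z" "C' \<in> Fpow Z" and ne: "B' \<noteq> {}"
    then obtain A B C where ABC: "A \<in> Fpow Y" "B \<in> Fpow Y" "C \<in> Fpow Y"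
      "A' = j ` A" "B' = j ` B" "C' = j ` C"
      using pre by metis
    moreover have "A \<union> B \<in> Fpow Y" "B \<union> C \<in> Fpow Y" "A \<union> C \<in> Fpow Y"
      using ABC by (auto simp: Fpow_def)
    ultimately show "\<delta>Z (A' \<union> C') \<le> \<delta>Z (A' \<union> B') + \<delta>Z (B' \<union> C')"
      using d ne Y.triangle[of A B C] by (auto simp flip: image_Un)
  qed
  interpret M: Metric_space12 Y "induced_metric Y \<delta>Y" Z "induced_metric Z \<delta>Z"
    by (intro Metric_space12.intro Y.Metric_space diversity.Metric_space[OF Z])
  have "homeomorphic_map M.M1.mtopology M.M2.mtopology j"
  proof (rule M.isometry_imp_homeomorphic_map)
    show "j ` Y = Z" by (rule j)
    show "induced_metric Z \<delta>Z (j x) (j y) = induced_metric Y \<delta>Y x y" if "x \<in> Y" "y \<in> Y" for x y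
      using that j d[of "{x, y}"] by (auto simp: induced_metric_def Fpow_def)
  qed
  then have "M.M1.mtopology homeomorphic_space M.M2.mtopology"
    by (rule homeomorphic_map_imp_homeomorphic_space)
  then show ?thesis
    using Y Z homeomorphic_separable_space by (auto simp: separable_diversity_def)
qed

lemma universal_diversity_any_type:
  fixes Y :: "'b set"
  assumes "universal_diversity X \<delta>" "separable_diversity Y \<delta>Y"
  shows "\<exists>Z \<subseteq> X. isomorphic_diversities Y \<delta>Y Z \<delta>"
proof -
  obtain j :: "'b \<Rightarrow> real" where j: "inj_on j Y"
    using separable_diversity_inj_real assms(2) by blast
  define \<delta>R where "\<delta>R A = \<delta>Y (inv_into Y j ` A)" for A
  have iso: "diversity_iso Y \<delta>Y (j ` Y) \<delta>R j"
    using j by (auto simp: diversity_iso_def bij_betw_def \<delta>R_def Fpow_def inv_into_image_cancel)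
  then have "separable_diversity (j ` Y) \<delta>R"
    using assms(2) separable_diversity_iso by blast
  then obtain Z \<phi> where Z: "Z \<subseteq> X" "diversity_iso (j ` Y) \<delta>R Z \<delta> \<phi>"
    using assms(1) unfolding universal_diversity_def isomorphic_diversities_def by metis
  have "diversity_iso Y \<delta>Y Z \<delta> (\<phi> \<circ> j)"
    unfolding diversity_iso_def
  proof (intro conjI ballI)
    show "bij_betw (\<phi> \<circ> j) Y Z"
      using iso Z(2) by (auto simp: diversity_iso_def intro: bij_betw_trans)
    fix A assume A: "A \<in> Fpow Y"
    then have "j ` A \<in> Fpow (j ` Y)" by (auto simp: Fpow_def)
    then show "\<delta> ((\<phi> \<circ> j) ` A) = \<delta>Y A"
      using iso Z(2) A unfolding diversity_iso_def by (metis image_comp)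
  qed
  then show ?thesis using Z(1) by (auto simp: isomorphic_diversities_def)
qed

end

theory Submission
  imports Defs
begin

text \<open>
  Universality provides a copy in \<open>X\<close> of any one-point extension of a finite \<open>F \<subseteq> X\<close>, and
  ultrahomogeneity moves that copy so that it extends \<open>F\<close> itself; this is the extension property.

  The union \<open>T\<close> of the tower has the exact extension property already before completion: a
  one-point extension of a finite subset of a stage is realised in the next stage by its
  finitely supported extension. Since \<open>T\<close> is separable, a back-and-forth argument between
  countable dense subsets of \<open>X\<close> and \<open>T\<close> yields an isomorphism between dense subsets, so the
  complete diversity \<open>X\<close> is the completion of \<open>T\<close>. The extension property of the completion
  of \<open>T\<close>, which would need an approximation argument, is never used.
\<close>

section \<open>Admissible functions\<close>

text \<open>The existential definition of \<open>adm_fun\<close> is awkward to verify for an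
  infimum, so it is replaced by four inequalities on \<open>f\<close> alone. The last of them,
  \<open>f_link\<close>, has the shape of (D2) with a one-point middle set. Iterated, it trades a
  family of sets for a family of points, and this single device (\<open>UN_link\<close>) yields the
  boundedness of the suprema in \<open>delta_hat\<close>, the isometry of \<open>kappa\<close> and
  the main properties of finitely supported extensions. Finite support keeps the tower separable:
  such a function is determined by its support and by finitely many values, and both can be taken
  from countable sets up to a small error. The delicate point is that the support has to be moved
  into a given dense set. Both sides of the back-and-forth have the exact extension property, so
  every finite partial isomorphism preserves the diversity exactly and no errors accumulate.
  Estimates enter only in the passage to limits, where a diversity is Lipschitz in its
  points.\<close>

lemma Fpow_iff: "A \<in> Fpow X \<longleftrightarrow> A \<subseteq> X \<and> finite A"
  by (simp add: Fpow_def)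

section \<open>Elementary inequalities in a diversity\<close>

context diversity
begin

lemma singleton: "x \<in> X \<Longrightarrow> \<delta> {x} = 0"
  using zero_iff[of "{x}"] by (simp add: Fpow_iff)

lemma empty: "\<delta> {} = 0"
  using zero_iff[of "{}"] by (simp add: Fpow_iff)

lemma eq_if_zero:
  assumes "x \<in> X" "y \<in> X" "\<delta> {x, y} = 0"
  shows "x = y"
  using assms zero_iff[of "{x, y}"] by (auto simp: Fpow_iff card_insert_if split: if_splits)

lemma link:
  assumes "A \<in> Fpow X" "B \<in> Fpow X" "x \<in> X"
  shows "\<delta> (A \<union> B) \<le> \<delta> (insert x A) + \<delta> (insert x B)"
  using triangle[of A "{x}" B] assms by (simp add: Fpow_iff)

text \<open>Adding one point \<open>b\<close> cannot decrease \<delta>: in \<open>link\<close> with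
  an empty second set the extra term is \<open>\<delta> {b} = 0\<close>. Induction adds the points
  of \<open>B\<close>.\<close>

lemma mono:
  assumes "A \<subseteq> B" "B \<in> Fpow X"
  shows "\<delta> A \<le> \<delta> B"
proof -
  have ins: "\<delta> A \<le> \<delta> (insert b A)" if "A \<in> Fpow X" "b \<in> X" for A b
    using link[of A "{}" b] that singleton by (simp add: Fpow_iff)
  have "B \<subseteq> X" using assms by (auto simp: Fpow_iff)
  have "\<delta> A \<le> \<delta> (A \<union> C)" if "finite C" "C \<subseteq> X" for C
    using that
  proof induction
    case (insert c C)
    then show ?case
      using ins[of "A \<union> C" c] assms finite_subset[of A B] \<open>B \<subseteq> X\<close>
      by (simp add: Fpow_iff subset_trans[OF assms(1)])
  qed simp
  from this[of B] show ?thesis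
    using assms by (simp add: Fpow_iff Un_absorb1)
qed

lemma overlap:
  assumes "A \<in> Fpow X" "B \<in> Fpow X" "x \<in> A" "x \<in> B"
  shows "\<delta> (A \<union> B) \<le> \<delta> A + \<delta> B"
  using link[of A B x] assms by (auto simp: Fpow_iff insert_absorb)

text \<open>The sets \<open>A i\<close> are traded for the points \<open>u i\<close> one at a time,
  each at the cost \<open>\<delta> (insert (u i) (A i))\<close>; \<open>C\<close> is arbitrary in
  the induction so that it can hold the set not yet traded. The function \<open>h\<close> is a
  parameter because both \<delta> (by \<open>link\<close>) and every admissible function (by
  \<open>f_link\<close>) satisfy the premise.\<close>

lemma UN_link:
  assumes h: "\<And>A B x. A \<in> Fpow X \<Longrightarrow> B \<in> Fpow X \<Longrightarrow> x \<in> X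
                \<Longrightarrow> h (A \<union> B) \<le> h (insert x A) + \<delta> (insert x B)"
    and "finite I" "\<And>i. i \<in> I \<Longrightarrow> A i \<in> Fpow X" "\<And>i. i \<in> I \<Longrightarrow> u i \<in> X" "C \<in> Fpow X"
  shows "h ((\<Union>i\<in>I. A i) \<union> C) \<le> h (u ` I \<union> C) + (\<Sum>i\<in>I. \<delta> (insert (u i) (A i)))"
  using assms(2-)
proof (induction arbitrary: C)
  case (insert i I)
  have fin: "A i \<union> C \<in> Fpow X" "u ` I \<union> C \<in> Fpow X"
    using insert.prems insert.hyps by (auto simp: Fpow_iff)
  have "h ((\<Union>i\<in>insert i I. A i) \<union> C) = h ((\<Union>i\<in>I. A i) \<union> (A i \<union> C))"
    by (simp add: Un_ac)
  also have "\<dots> \<le> h (u ` I \<union> (A i \<union> C)) + (\<Sum>i\<in>I. \<delta> (insert (u i) (A i)))"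
    using insert.IH[of "A i \<union> C"] insert.prems fin by simp
  also have "u ` I \<union> (A i \<union> C) = (u ` I \<union> C) \<union> A i"
    by auto
  also have "h \<dots> \<le> h (insert (u i) (u ` I \<union> C)) + \<delta> (insert (u i) (A i))"
    using h[of "u ` I \<union> C" "A i" "u i"] insert.prems fin by simp
  finally show ?case
    using insert.hyps by (simp add: algebra_simps)
qed simp

lemma image_le:
  assumes "finite I" "u ` I \<subseteq> X" "v ` I \<subseteq> X"
  shows "\<delta> (v ` I) \<le> \<delta> (u ` I) + (\<Sum>i\<in>I. \<delta> {u i, v i})"
  using UN_link[of \<delta> I "\<lambda>i. {v i}" u "{}"] assms link
  by (auto simp: Fpow_iff UNION_singleton_eq_range)

lemma subset:
  assumes "Y \<subseteq> X"
  shows "diversity Y \<delta>"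
proof -
  have "A \<in> Fpow X" if "A \<in> Fpow Y" for A
    using that assms by (auto simp: Fpow_iff)
  then show ?thesis
    by unfold_locales (use nonneg zero_iff triangle in auto)
qed

end

text \<open>Intrinsic form of the predicate \<open>adm_fun\<close>; the lemmas
  \<open>adm_fun\<close> and \<open>adm_fun_imp_admissible\<close> show the equivalence. With
  \<open>f A\<close> read as the diversity of \<open>A\<close> together with a new point
  \<open>z\<close>, \<open>f_ge\<close> is monotonicity, \<open>f_Un\<close> is overlap in
  \<open>z\<close>, and \<open>f_link\<close> is (D2) with middle set \<open>{x}\<close> and
  \<open>z\<close> adjoined to \<open>A\<close>.\<close>

locale admissible = diversity X \<delta> for X :: "'a set" and \<delta> +
  fixes f :: "'a set \<Rightarrow> real"
  assumes f_empty: "f {} = 0"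
    and f_ge: "A \<in> Fpow X \<Longrightarrow> \<delta> A \<le> f A"
    and f_Un: "\<lbrakk>A \<in> Fpow X; B \<in> Fpow X\<rbrakk> \<Longrightarrow> f (A \<union> B) \<le> f A + f B"
    and f_link: "\<lbrakk>A \<in> Fpow X; B \<in> Fpow X; x \<in> X\<rbrakk>
                  \<Longrightarrow> f (A \<union> B) \<le> f (insert x A) + \<delta> (insert x B)"
begin

lemma f_nonneg: "A \<in> Fpow X \<Longrightarrow> 0 \<le> f A"
  using f_ge nonneg by fastforce

lemma f_mono:
  assumes "A \<subseteq> B" "B \<in> Fpow X"
  shows "f A \<le> f B"
proof -
  have "B \<subseteq> X" using assms by (auto simp: Fpow_iff)
  have ins: "f A \<le> f (insert b A)" if "A \<in> Fpow X" "b \<in> X" for A b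
    using f_link[of A "{}" b] that singleton by (simp add: Fpow_iff)
  have "f A \<le> f (A \<union> C)" if "finite C" "C \<subseteq> X" for C
    using that
  proof induction
    case (insert c C)
    then show ?case
      using ins[of "A \<union> C" c] assms finite_subset[of A B] \<open>B \<subseteq> X\<close>
      by (simp add: Fpow_iff subset_trans[OF assms(1)])
  qed simp
  from this[of B] show ?thesis
    using assms by (simp add: Fpow_iff Un_absorb1)
qed

lemma f_UN:
  assumes "finite I" "\<And>i. i \<in> I \<Longrightarrow> A i \<in> Fpow X" "C \<in> Fpow X"
  shows "f ((\<Union>i\<in>I. A i) \<union> C) \<le> (\<Sum>i\<in>I. f (A i)) + f C"
  using assms
proof (induction)
  case (insert i I)
  then show ?case
    using f_Un[of "A i" "(\<Union>i\<in>I. A i) \<union> C"]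
    by (simp add: Fpow_iff Un_assoc UN_subset_iff)
qed simp

text \<open>A new point at distance zero from \<open>x\<close> must be \<open>x\<close> itself:
  \<open>f_link\<close> through \<open>x\<close> and \<open>f_Un\<close> with \<open>{x}\<close>
  both lose nothing. This is the degenerate case of \<open>adm_fun\<close>.\<close>

lemma f_zero:
  assumes "x \<in> X" "f {x} = 0" "A \<in> Fpow X"
  shows "f A = \<delta> (insert x A)"
proof (rule antisym)
  show "f A \<le> \<delta> (insert x A)"
    using f_link[of "{}" A x] assms by (simp add: Fpow_iff)
  have "\<delta> (insert x A) \<le> f (insert x A)"
    using assms by (intro f_ge) (simp add: Fpow_iff)
  also have "\<dots> \<le> f {x} + f A"
    using f_Un[of "{x}" A] assms by (simp add: Fpow_iff)
  finally show "\<delta> (insert x A) \<le> f A" using assms by simp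
qed

lemma admissible_subset:
  assumes "S \<subseteq> X"
  shows "admissible S \<delta> f"
proof -
  have *: "A \<in> Fpow X" if "A \<in> Fpow S" for A
    using that assms by (auto simp: Fpow_iff)
  interpret S: diversity S \<delta> by (rule subset[OF assms])
  show ?thesis
    by unfold_locales (use * assms in \<open>auto intro: f_empty f_ge f_Un f_link\<close>)
qed

text \<open>The new point is taken to be \<open>Some x\<close> if \<open>f {x} = 0\<close>, since a
  separate point at distance zero would violate (D1), and \<open>None\<close> otherwise.\<close>

lemma adm_fun: "adm_fun X \<delta> f"
proof (cases "\<exists>x\<in>X. f {x} = 0")
  case True
  then obtain x where x: "x \<in> X" "f {x} = 0" by blast
  have "diversity (Some ` X) (\<lambda>B. \<delta> (the ` B))"
  proof
    fix B assume "B \<in> Fpow (Some ` X)"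
    then obtain A where "A \<in> Fpow X" "B = Some ` A"
      by (auto simp: Fpow_iff dest: finite_subset_image)
    then show "0 \<le> \<delta> (the ` B)" "\<delta> (the ` B) = 0 \<longleftrightarrow> card B \<le> 1"
      using nonneg zero_iff by (auto simp: image_image card_image)
  next
    fix A B C :: "'a option set"
    assume "A \<in> Fpow (Some ` X)" "B \<in> Fpow (Some ` X)" "C \<in> Fpow (Some ` X)" "B \<noteq> {}"
    then show "\<delta> (the ` (A \<union> C)) \<le> \<delta> (the ` (A \<union> B)) + \<delta> (the ` (B \<union> C))"
      unfolding image_Un by (intro triangle) (auto simp: Fpow_iff)
  qed
  then have "diversity (insert (Some x) (Some ` X)) (\<lambda>B. \<delta> (the ` B))"
    using x by (simp add: insert_absorb)
  then show ?thesis
    unfolding adm_fun_def using f_zero[OF x] by (force simp: image_image)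
next
  case False
  define \<delta>' where "\<delta>' B = (let A = the ` (B - {None}) in if None \<in> B then f A else \<delta> A)" for B
  have pos: "f A \<noteq> 0" if A: "A \<in> Fpow X" "A \<noteq> {}" for A
  proof -
    from A obtain a where a: "a \<in> A" "a \<in> X" by (auto simp: Fpow_iff)
    then show ?thesis
      using A f_mono[of "{a}" A] f_nonneg[of "{a}"] False by (force simp: Fpow_iff)
  qed
  have fpow: "the ` (B - {None}) \<in> Fpow X" if "B \<in> Fpow (insert None (Some ` X))" for B
    using that by (auto simp: Fpow_iff)
  have card: "card (the ` (B - {None})) = card (B - {None})" for B :: "'a option set"
    by (intro card_image inj_onI) (auto simp: option.expand)
  \<comment> \<open>\<open>f3\<close>, \<open>d3\<close> and \<open>fd\<close> are the instances of
    (D2) for \<open>\<delta>'\<close>, sorted by which of the three sets contain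
    \<open>None\<close>. In \<open>fd\<close> only one outer set contains it, so a point
    \<open>b\<close> of the middle set has to serve as the link.\<close>
  have f3: "f (A \<union> C) \<le> f (A \<union> B) + f (B \<union> C)"
    if "A \<in> Fpow X" "B \<in> Fpow X" "C \<in> Fpow X" for A B C
  proof -
    have "f (A \<union> C) \<le> f ((A \<union> B) \<union> (B \<union> C))"
      using that by (intro f_mono) (auto simp: Fpow_iff)
    then show ?thesis
      using f_Un[of "A \<union> B" "B \<union> C"] that by (auto simp: Fpow_iff)
  qed
  have d3: "\<delta> (A \<union> C) \<le> f (A \<union> B) + f (B \<union> C)"
    if "A \<in> Fpow X" "B \<in> Fpow X" "C \<in> Fpow X" for A B C
    using f3[of A B C] f_ge[of "A \<union> C"] that by (auto simp: Fpow_iff)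
  have fd: "f (A \<union> C) \<le> f (A \<union> B) + \<delta> (B \<union> C)"
    if "A \<in> Fpow X" "B \<in> Fpow X" "C \<in> Fpow X" "B \<noteq> {}" for A B C
  proof -
    from that obtain b where "b \<in> B" "b \<in> X" by (auto simp: Fpow_iff)
    then show ?thesis
      using that f_link[of A C b] f_mono[of "insert b A" "A \<union> B"] mono[of "insert b C" "B \<union> C"]
      by (auto simp: Fpow_iff)
  qed
  have "diversity (insert None (Some ` X)) \<delta>'"
  proof
    fix B :: "'a option set" assume B: "B \<in> Fpow (insert None (Some ` X))"
    let ?A = "the ` (B - {None})"
    have A: "?A \<in> Fpow X" by (rule fpow[OF B])
    then show "0 \<le> \<delta>' B"
      using nonneg[OF A] f_nonneg[OF A] unfolding \<delta>'_def Let_def by metis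
    show "\<delta>' B = 0 \<longleftrightarrow> card B \<le> 1"
    proof (cases "None \<in> B")
      case True
      then have "card B = Suc (card ?A)"
        using B card.remove[of B None] card[of B] unfolding Fpow_iff by metis
      moreover have "card ?A = 0 \<longleftrightarrow> ?A = {}"
        using A by (simp add: Fpow_iff)
      moreover have "\<delta>' B = f ?A"
        using True by (simp only: \<delta>'_def Let_def if_True)
      moreover have "f ?A = 0 \<longleftrightarrow> ?A = {}"
        using pos[OF A] f_empty by metis
      ultimately show ?thesis
        by (simp only: One_nat_def Suc_le_mono le_zero_eq)
    next
      case False
      then show ?thesis
        using zero_iff[OF A] card[of B] by (simp add: \<delta>'_def Let_def)
    qed
  next
    fix A B C :: "'a option set"
    assume A: "A \<in> Fpow (insert None (Some ` X))" and B: "B \<in> Fpow (insert None (Some ` X))"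
      and C: "C \<in> Fpow (insert None (Some ` X))" and "B \<noteq> {}"
    define a b c where "a = the ` (A - {None})" "b = the ` (B - {None})" "c = the ` (C - {None})"
    have p: "a \<in> Fpow X" "b \<in> Fpow X" "c \<in> Fpow X"
      unfolding a_b_c_def by (intro fpow A B C)+
    have eq: "\<delta>' (A \<union> C) = (if None \<in> A \<or> None \<in> C then f (a \<union> c) else \<delta> (a \<union> c))"
      "\<delta>' (A \<union> B) = (if None \<in> A \<or> None \<in> B then f (a \<union> b) else \<delta> (a \<union> b))"
      "\<delta>' (B \<union> C) = (if None \<in> B \<or> None \<in> C then f (b \<union> c) else \<delta> (b \<union> c))"
      by (simp_all only: \<delta>'_def a_b_c_def Let_def Un_Diff image_Un Un_iff)
    show "\<delta>' (A \<union> C) \<le> \<delta>' (A \<union> B) + \<delta>' (B \<union> C)"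
    proof (cases "None \<in> B")
      case True
      then show ?thesis
        using f3[OF p] d3[OF p] by (simp add: eq)
    next
      case False
      then have ne: "b \<noteq> {}"
        using \<open>B \<noteq> {}\<close> by (simp add: a_b_c_def)
      have "f (a \<union> c) \<le> \<delta> (a \<union> b) + f (b \<union> c)"
        using fd[OF p(3) p(2) p(1) ne] by (simp add: Un_commute add.commute)
      then show ?thesis
        using triangle[OF p ne] f3[OF p] fd[OF p ne] False by (simp add: eq)
    qed
  qed
  then show ?thesis
    unfolding adm_fun_def
    by (intro exI[of _ None] exI[of _ \<delta>']) (auto simp: \<delta>'_def image_image image_iff)
qed

end

lemma (in diversity) adm_fun_imp_admissible:
  assumes "adm_fun X \<delta> f"
  shows "admissible X \<delta> f"
proof -
  obtain z :: "'a option" and \<delta>' where z: "diversity (insert z (Some ` X)) \<delta>'"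
    and d: "\<And>A. A \<in> Fpow X \<Longrightarrow> \<delta>' (Some ` A) = \<delta> A"
    and f: "\<And>A. A \<in> Fpow X \<Longrightarrow> \<delta>' (insert z (Some ` A)) = f A"
    using assms unfolding adm_fun_def by blast
  interpret Z: diversity "insert z (Some ` X)" \<delta>' by fact
  have F: "Some ` A \<in> Fpow (insert z (Some ` X))" "insert z (Some ` A) \<in> Fpow (insert z (Some ` X))"
    if "A \<in> Fpow X" for A
    using that by (auto simp: Fpow_iff)
  show ?thesis
  proof
    show "f {} = 0" using f[of "{}"] Z.singleton[of z] by (simp add: Fpow_iff)
  next
    fix A assume A: "A \<in> Fpow X"
    then show "\<delta> A \<le> f A"
      using Z.mono[OF _ F(2)[OF A], of "Some ` A"] d f by auto
    fix B assume B: "B \<in> Fpow X"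
    have AB: "A \<union> B \<in> Fpow X" using A B by (auto simp: Fpow_iff)
    show "f (A \<union> B) \<le> f A + f B"
      using Z.overlap[OF F(2)[OF A] F(2)[OF B], of z] f[OF A] f[OF B] f[OF AB]
      by (simp add: image_Un)
    fix x assume x: "x \<in> X"
    have xA: "insert x A \<in> Fpow X" and xB: "insert x B \<in> Fpow X"
      using A B x by (auto simp: Fpow_iff)
    have "f (A \<union> B) = \<delta>' (insert z (Some ` A) \<union> Some ` B)"
      using f[OF AB] by (simp add: image_Un)
    also have "\<dots> \<le> \<delta>' (insert (Some x) (insert z (Some ` A))) + \<delta>' (insert (Some x) (Some ` B))"
      using x by (intro Z.link F A B) auto
    also have "\<dots> = f (insert x A) + \<delta> (insert x B)"
      using f[OF xA] d[OF xB] by (simp add: insert_commute)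
    finally show "f (A \<union> B) \<le> f (insert x A) + \<delta> (insert x B)" .
  qed
qed

lemma admissible_cong:
  assumes "admissible X \<delta> f" "\<And>A. A \<in> Fpow X \<Longrightarrow> g A = f A"
  shows "admissible X \<delta> g"
proof -
  interpret admissible X \<delta> f by fact
  have *: "{} \<in> Fpow X" "\<And>A B. A \<in> Fpow X \<Longrightarrow> B \<in> Fpow X \<Longrightarrow> A \<union> B \<in> Fpow X"
    "\<And>x A. x \<in> X \<Longrightarrow> A \<in> Fpow X \<Longrightarrow> insert x A \<in> Fpow X"
    by (auto simp: Fpow_iff)
  show ?thesis
    by unfold_locales (use f_empty f_ge f_Un f_link assms(2) * in auto)
qed

lemma (in diversity) adm_space_iff:
  "f \<in> adm_space X \<delta> \<longleftrightarrow> f \<in> extensional (Fpow X) \<and> admissible X \<delta> f"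
  using adm_fun_imp_admissible admissible.adm_fun by (auto simp: adm_space_def)

lemma (in admissible) restrict_adm_space:
  assumes "S \<subseteq> X"
  shows "restrict f (Fpow S) \<in> adm_space S \<delta>"
proof -
  interpret S: admissible S \<delta> f by (rule admissible_subset[OF assms])
  show ?thesis
    unfolding S.adm_space_iff using admissible_cong[OF S.admissible_axioms] by auto
qed

lemma (in diversity) admissible_insert:
  assumes "x \<in> X"
  shows "admissible X \<delta> (\<lambda>A. \<delta> (insert x A))"
proof
  show "\<delta> {x} = 0" using assms singleton by simp
next
  fix A assume A: "A \<in> Fpow X"
  then show "\<delta> A \<le> \<delta> (insert x A)"
    using assms by (intro mono) (auto simp: Fpow_iff)
  fix B assume B: "B \<in> Fpow X"
  show "\<delta> (insert x (A \<union> B)) \<le> \<delta> (insert x A) + \<delta> (insert x B)"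
    using overlap[of "insert x A" "insert x B" x] A B assms by (simp add: Fpow_iff)
  fix y assume "y \<in> X"
  then show "\<delta> (insert x (A \<union> B)) \<le> \<delta> (insert x (insert y A)) + \<delta> (insert y B)"
    using link[of "insert x A" B y] A B assms by (simp add: Fpow_iff insert_commute)
qed

lemma (in diversity) kappa_adm_space: "x \<in> X \<Longrightarrow> kappa X \<delta> x \<in> adm_space X \<delta>"
  unfolding kappa_def by (rule admissible.restrict_adm_space[OF admissible_insert]) auto

section \<open>The diversity on the space of admissible functions\<close>

lemma (in diversity) adm_spaceD: "f \<in> adm_space X \<delta> \<Longrightarrow> admissible X \<delta> f"
  by (simp add: adm_space_iff)

lemma (in diversity) adm_space_eqI:
  assumes "f \<in> adm_space X \<delta>" "g \<in> adm_space X \<delta>" "\<And>A. A \<in> Fpow X \<Longrightarrow> f A = g A"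
  shows "f = g"
  using assms by (auto simp: adm_space_iff intro: extensionalityI)

lemma kappa_apply: "A \<in> Fpow X \<Longrightarrow> kappa X \<delta> x A = \<delta> (insert x A)"
  by (simp add: kappa_def)

section \<open>Bounds for \<open>delta_hat\<close> and the axioms (D1), (D2)\<close>

locale nonempty_diversity = diversity X \<delta> for X :: "'a set" and \<delta> +
  assumes nonempty: "X \<noteq> {}"
begin

text \<open>Trading each \<open>A g\<close> for a fixed base point \<open>x\<close> costs
  \<open>\<delta> (insert x (A g))\<close>, which is at most \<open>g {x} + g (A g)\<close>; the
  subtracted sum cancels the second terms and leaves a bound independent of the family. Only with
  such a bound does the real supremum in \<open>delta_hat\<close> have its usual meaning.\<close>

lemma delta_hat_bdd:
  assumes F: "F \<in> Fpow (adm_space X \<delta>)" and f: "f \<in> F"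
  shows "bdd_above ((\<lambda>A. f (\<Union>g \<in> F - {f}. A g) - (\<Sum>g \<in> F - {f}. g (A g))) ` (F \<rightarrow> Fpow X))"
proof -
  obtain x where x: "x \<in> X" using nonempty by blast
  interpret f: admissible X \<delta> f using F f by (auto simp: Fpow_iff intro: adm_spaceD)
  have "f (\<Union>g \<in> F - {f}. A g) - (\<Sum>g \<in> F - {f}. g (A g)) \<le> f {x} + (\<Sum>g \<in> F - {f}. g {x})"
    if A: "A \<in> F \<rightarrow> Fpow X" for A
  proof -
    have fin: "finite (F - {f})" using F by (simp add: Fpow_iff)
    have A': "A g \<in> Fpow X" if "g \<in> F - {f}" for g using A that by auto
    have "f (\<Union>g \<in> F - {f}. A g) \<le> f ((\<Union>g \<in> F - {f}. A g) \<union> {x})"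
      using A' fin x by (intro f.f_mono) (auto simp: Fpow_iff)
    also have "\<dots> \<le> f ((\<lambda>_. x) ` (F - {f}) \<union> {x}) + (\<Sum>g \<in> F - {f}. \<delta> (insert x (A g)))"
      using A' fin x by (intro UN_link f.f_link) (auto simp: Fpow_iff)
    also have "(\<lambda>_. x) ` (F - {f}) \<union> {x} = {x}" by auto
    also have "(\<Sum>g \<in> F - {f}. \<delta> (insert x (A g))) \<le> (\<Sum>g \<in> F - {f}. g {x} + g (A g))"
    proof (rule sum_mono)
      fix g assume g: "g \<in> F - {f}"
      then interpret g: admissible X \<delta> g using F by (auto simp: Fpow_iff intro: adm_spaceD)
      show "\<delta> (insert x (A g)) \<le> g {x} + g (A g)"
        using g.f_ge[of "insert x (A g)"] g.f_Un[of "{x}" "A g"] A'[OF g] x by (simp add: Fpow_iff)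
    qed
    finally show ?thesis by (simp add: sum.distrib)
  qed
  then show ?thesis by (intro bdd_aboveI2) auto
qed

text \<open>
  By subadditivity of \<open>f\<close>, the index \<open>g = f\<close>, which \<^const>\<open>delta_hat\<close> leaves out, may be
  included in the union and in the sum. This spares the case distinctions below, and makes the
  characterisation hold for \<open>card F \<le> 1\<close> as well.
\<close>

lemma delta_hat_le_iff:
  assumes F: "F \<in> Fpow (adm_space X \<delta>)"
  shows "delta_hat X F \<le> c \<longleftrightarrow>
    0 \<le> c \<and> (\<forall>f\<in>F. \<forall>A\<in>F \<rightarrow> Fpow X. f (\<Union>g\<in>F. A g) \<le> c + (\<Sum>g\<in>F. g (A g)))"
proof (cases "card F \<le> 1")
  case True
  then consider "F = {}" | f where "F = {f}"
    using F by (metis Fpow_iff One_nat_def card_1_singletonE card_eq_0_iff le_Suc_eq le_zero_eq)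
  then show ?thesis
    by cases (auto simp: delta_hat_def)
next
  case False
  have fin: "finite F" "F \<noteq> {}" using F False by (auto simp: Fpow_iff)
  have "delta_hat X F \<le> c \<longleftrightarrow>
      (\<forall>f\<in>F. (SUP A \<in> F \<rightarrow> Fpow X. f (\<Union>g \<in> F - {f}. A g) - (\<Sum>g \<in> F - {f}. g (A g))) \<le> c)"
    using False fin by (simp add: delta_hat_def)
  also have "\<dots> \<longleftrightarrow> (\<forall>f\<in>F. \<forall>A\<in>F \<rightarrow> Fpow X.
      f (\<Union>g \<in> F - {f}. A g) - (\<Sum>g \<in> F - {f}. g (A g)) \<le> c)"
  proof (intro ball_cong refl cSUP_le_iff delta_hat_bdd[OF F])
    have "(\<lambda>_. {}) \<in> F \<rightarrow> Fpow X" by (simp add: Fpow_iff)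
    then show "F \<rightarrow> Fpow X \<noteq> {}" by blast
  qed
  also have "\<dots> \<longleftrightarrow> 0 \<le> c \<and> (\<forall>f\<in>F. \<forall>A\<in>F \<rightarrow> Fpow X. f (\<Union>g\<in>F. A g) \<le> c + (\<Sum>g\<in>F. g (A g)))"
    (is "?L \<longleftrightarrow> ?R")
  proof
    assume L: ?L
    have "0 \<le> c"
    proof -
      obtain f where f: "f \<in> F" using fin by blast
      have "\<forall>g\<in>F. g {} = 0"
        using F admissible.f_empty adm_spaceD by (fastforce simp: Fpow_iff)
      then have "(\<Sum>g \<in> F - {f}. g {}) = 0" "f {} = 0"
        using f by (auto intro: sum.neutral)
      then show ?thesis
        using L[rule_format, OF f, of "\<lambda>_. {}"] by (simp add: Fpow_iff)
    qed
    moreover have "f (\<Union>g\<in>F. A g) \<le> c + (\<Sum>g\<in>F. g (A g))" if f: "f \<in> F" and A: "A \<in> F \<rightarrow> Fpow X" for f A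
    proof -
      interpret f: admissible X \<delta> f using F f by (auto simp: Fpow_iff intro: adm_spaceD)
      have "(\<Union>g\<in>F. A g) = A f \<union> (\<Union>g \<in> F - {f}. A g)" using f by auto
      then have "f (\<Union>g\<in>F. A g) \<le> f (A f) + f (\<Union>g \<in> F - {f}. A g)"
        using f.f_Un[of "A f" "\<Union>g \<in> F - {f}. A g"] A f fin by (auto simp: Fpow_iff Pi_iff ball_Un)
      then show ?thesis
        using L[rule_format, OF f A] fin f by (simp add: sum.remove[of F f])
    qed
    ultimately show ?R by blast
  next
    assume R: ?R
    show ?L
    proof (intro ballI)
      fix f A assume f: "f \<in> F" and A: "A \<in> F \<rightarrow> Fpow X"
      \<comment> \<open>Emptying the set at index \<open>f\<close> removes it from the union and, as
        \<open>f {} = 0\<close>, from the sum as well.\<close>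
      let ?A = "A(f := {})"
      have "?A \<in> F \<rightarrow> Fpow X" using A by (simp add: Pi_iff Fpow_iff)
      with R f have "f (\<Union>g\<in>F. ?A g) \<le> c + (\<Sum>g\<in>F. g (?A g))" by blast
      moreover have "(\<Union>g\<in>F. ?A g) = (\<Union>g \<in> F - {f}. A g)" by auto
      moreover have "(\<Sum>g\<in>F. g (?A g)) = (\<Sum>g \<in> F - {f}. g (A g))"
      proof -
        have "f {} = 0"
          using F f admissible.f_empty adm_spaceD by (fastforce simp: Fpow_iff)
        then show ?thesis using fin f by (simp add: sum.remove[of F f])
      qed
      ultimately show "f (\<Union>g \<in> F - {f}. A g) - (\<Sum>g \<in> F - {f}. g (A g)) \<le> c" by simp
    qed
  qed
  finally show ?thesis .
qed

lemma delta_hat_nonneg: "F \<in> Fpow (adm_space X \<delta>) \<Longrightarrow> 0 \<le> delta_hat X F"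
  using delta_hat_le_iff[of F "delta_hat X F"] by simp

text \<open>Sets carrying the same label are merged into one set \<open>B g\<close>, which by
  subadditivity of \<open>g\<close> is no more expensive. Repeated labels occur in the proof of (D2)
  below, where the auxiliary point \<open>g\<close> may already belong to the family.\<close>

lemma delta_hat_UN:
  assumes F: "F \<in> Fpow (adm_space X \<delta>)" and f: "f \<in> F"
    and I: "finite I" "\<And>i. i \<in> I \<Longrightarrow> \<phi> i \<in> F" "\<And>i. i \<in> I \<Longrightarrow> A i \<in> Fpow X"
  shows "f (\<Union>i\<in>I. A i) \<le> delta_hat X F + (\<Sum>i\<in>I. \<phi> i (A i))"
proof -
  define B where "B g = (\<Union>i\<in>{i\<in>I. \<phi> i = g}. A i)" for g
  have B: "B \<in> F \<rightarrow> Fpow X"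
    using I by (simp add: B_def Fpow_iff Pi_iff UN_subset_iff)
  have "(\<Union>i\<in>I. A i) = (\<Union>g\<in>F. B g)"
    using I(2) by (auto simp: B_def)
  then have "f (\<Union>i\<in>I. A i) \<le> delta_hat X F + (\<Sum>g\<in>F. g (B g))"
    using delta_hat_le_iff[OF F, of "delta_hat X F"] f B by auto
  also have "(\<Sum>g\<in>F. g (B g)) \<le> (\<Sum>g\<in>F. \<Sum>i\<in>{i\<in>I. \<phi> i = g}. \<phi> i (A i))"
  proof (rule sum_mono)
    fix g assume "g \<in> F"
    then interpret g: admissible X \<delta> g using F by (auto simp: Fpow_iff intro: adm_spaceD)
    show "g (B g) \<le> (\<Sum>i\<in>{i\<in>I. \<phi> i = g}. \<phi> i (A i))"
      using g.f_UN[of "{i\<in>I. \<phi> i = g}" A "{}"] I by (simp add: B_def g.f_empty Fpow_iff)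
  qed
  also have "\<dots> = (\<Sum>i\<in>I. \<phi> i (A i))"
    using F I by (intro sum.group) (auto simp: Fpow_iff)
  finally show ?thesis by simp
qed

lemma delta_hat_mono:
  assumes "F \<subseteq> G" and G: "G \<in> Fpow (adm_space X \<delta>)"
  shows "delta_hat X F \<le> delta_hat X G"
proof -
  have F: "F \<in> Fpow (adm_space X \<delta>)" using assms by (auto simp: Fpow_iff intro: finite_subset)
  show ?thesis
    unfolding delta_hat_le_iff[OF F]
    using assms F by (intro conjI ballI delta_hat_nonneg delta_hat_UN)
      (auto simp: Pi_iff Fpow_iff)
qed

text \<open>A family of one set, labelled by the other function, gives the bound. Together with
  \<open>delta_hat_pair_le\<close> it identifies the induced metric as the supremum distance between
  functions.\<close>

lemma delta_hat_pair_ge: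
  assumes "f \<in> adm_space X \<delta>" "g \<in> adm_space X \<delta>" "A \<in> Fpow X"
  shows "\<bar>f A - g A\<bar> \<le> delta_hat X {f, g}"
  using delta_hat_UN[of "{f, g}" f "{()}" "\<lambda>_. g" "\<lambda>_. A"]
    delta_hat_UN[of "{f, g}" g "{()}" "\<lambda>_. f" "\<lambda>_. A"] assms
  by (simp add: Fpow_iff)

lemma delta_hat_pair_le:
  assumes f: "f \<in> adm_space X \<delta>" and g: "g \<in> adm_space X \<delta>"
    and c: "\<And>A. A \<in> Fpow X \<Longrightarrow> \<bar>f A - g A\<bar> \<le> c"
  shows "delta_hat X {f, g} \<le> c"
proof -
  interpret f: admissible X \<delta> f by (rule adm_spaceD[OF f])
  interpret g: admissible X \<delta> g by (rule adm_spaceD[OF g])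
  have "0 \<le> c" using c[of "{}"] by (simp add: Fpow_iff)
  show ?thesis
  proof (cases "f = g")
    case True
    then show ?thesis using \<open>0 \<le> c\<close> by (simp add: delta_hat_def)
  next
    case False
    have F: "{f, g} \<in> Fpow (adm_space X \<delta>)" using f g by (simp add: Fpow_iff)
    show ?thesis
      unfolding delta_hat_le_iff[OF F]
    proof (intro conjI ballI)
      fix h A assume h: "h \<in> {f, g}" and A: "A \<in> {f, g} \<rightarrow> Fpow X"
      then have "f (A f \<union> A g) \<le> f (A f) + f (A g)" "g (A f \<union> A g) \<le> g (A f) + g (A g)"
        by (auto intro: f.f_Un g.f_Un)
      then show "h (\<Union>g\<in>{f, g}. A g) \<le> c + (\<Sum>g\<in>{f, g}. g (A g))"
        using h A c[of "A f"] c[of "A g"] False by auto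
    qed fact
  qed
qed

lemma diversity_delta_hat: "diversity (adm_space X \<delta>) (delta_hat X)"
proof
  fix F assume F: "F \<in> Fpow (adm_space X \<delta>)"
  then show "0 \<le> delta_hat X F" by (rule delta_hat_nonneg)
  show "delta_hat X F = 0 \<longleftrightarrow> card F \<le> 1"
  proof
    assume 0: "delta_hat X F = 0"
    have "f = g" if fg: "f \<in> F" "g \<in> F" for f g
    proof (rule adm_space_eqI)
      show "f \<in> adm_space X \<delta>" "g \<in> adm_space X \<delta>" using F fg by (auto simp: Fpow_iff)
      fix A assume "A \<in> Fpow X"
      then have "\<bar>f A - g A\<bar> \<le> delta_hat X {f, g}"
        using F fg by (intro delta_hat_pair_ge) (auto simp: Fpow_iff)
      also have "\<dots> \<le> 0" using delta_hat_mono[OF _ F, of "{f, g}"] 0 fg by simp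
      finally show "f A = g A" by simp
    qed
    then show "card F \<le> 1"
      using F by (auto simp: card_le_Suc0_iff_eq Fpow_iff)
  qed (simp add: delta_hat_def)
next
  fix F G H assume F: "F \<in> Fpow (adm_space X \<delta>)" and G: "G \<in> Fpow (adm_space X \<delta>)"
    and H: "H \<in> Fpow (adm_space X \<delta>)" and "G \<noteq> {}"
  then obtain g where g: "g \<in> G" by blast
  \<comment> \<open>The sets at indices in \<open>H - F\<close> are lumped together as
    \<open>B\<close> and charged to the chosen \<open>g\<close> in \<open>G\<close>:
    \<open>f\<close> is bounded inside \<open>F \<union> G\<close> with the extra term
    \<open>g B\<close>, and \<open>g B\<close> inside \<open>G \<union> H\<close>. The index
    \<open>None\<close> carries \<open>B\<close> even when \<open>g\<close> also lies in
    \<open>F\<close>, and \<open>H - F\<close> avoids counting common indices twice.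
    \<open>F\<close> and \<open>H\<close> are generalised so that their roles can be
    exchanged.\<close>
  have half: "f (\<Union>h\<in>F \<union> H. A h)
      \<le> delta_hat X (F \<union> G) + delta_hat X (G \<union> H) + (\<Sum>h\<in>F \<union> H. h (A h))"
    if F: "F \<in> Fpow (adm_space X \<delta>)" and H: "H \<in> Fpow (adm_space X \<delta>)"
      and f: "f \<in> F" and A: "A \<in> F \<union> H \<rightarrow> Fpow X" for F H f A
  proof -
    define B where "B = (\<Union>h\<in>H - F. A h)"
    have B: "B \<in> Fpow X" using A H by (simp add: B_def Fpow_iff Pi_iff UN_subset_iff)
    have finF: "finite F" "finite H" using F H by (auto simp: Fpow_iff)
    have FG: "F \<union> G \<in> Fpow (adm_space X \<delta>)" "G \<union> H \<in> Fpow (adm_space X \<delta>)"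
      using F G H by (auto simp: Fpow_iff)
    have "f (\<Union>i\<in>insert None (Some ` F). case i of None \<Rightarrow> B | Some h \<Rightarrow> A h)
        \<le> delta_hat X (F \<union> G) + (\<Sum>i\<in>insert None (Some ` F).
            (case i of None \<Rightarrow> g | Some h \<Rightarrow> h) (case i of None \<Rightarrow> B | Some h \<Rightarrow> A h))"
      using f finF A B g by (intro delta_hat_UN FG) auto
    also have "(\<Union>i\<in>insert None (Some ` F). case i of None \<Rightarrow> B | Some h \<Rightarrow> A h) = (\<Union>h\<in>F \<union> H. A h)"
      by (auto simp: B_def)
    also have "(\<Sum>i\<in>insert None (Some ` F).
            (case i of None \<Rightarrow> g | Some h \<Rightarrow> h) (case i of None \<Rightarrow> B | Some h \<Rightarrow> A h))
        = g B + (\<Sum>h\<in>F. h (A h))"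
      using F by (subst sum.insert) (auto simp: Fpow_iff sum.reindex)
    also have "g B \<le> delta_hat X (G \<union> H) + (\<Sum>h\<in>H - F. h (A h))"
      unfolding B_def using finF A g by (intro delta_hat_UN FG) auto
    also have "(\<Sum>h\<in>F \<union> H. h (A h)) = (\<Sum>h\<in>F. h (A h)) + (\<Sum>h\<in>H - F. h (A h))"
      using F H sum.union_disjoint[of F "H - F" "\<lambda>h. h (A h)"] by (simp add: Fpow_iff)
    ultimately show ?thesis by simp
  qed
  have FH: "F \<union> H \<in> Fpow (adm_space X \<delta>)" and "F \<union> G \<in> Fpow (adm_space X \<delta>)"
    "G \<union> H \<in> Fpow (adm_space X \<delta>)"
    using F G H by (auto simp: Fpow_iff)
  show "delta_hat X (F \<union> H) \<le> delta_hat X (F \<union> G) + delta_hat X (G \<union> H)"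
    unfolding delta_hat_le_iff[OF FH]
  proof (intro conjI ballI)
    show "0 \<le> delta_hat X (F \<union> G) + delta_hat X (G \<union> H)"
      by (intro add_nonneg_nonneg delta_hat_nonneg) fact+
    fix f A assume "f \<in> F \<union> H" "A \<in> F \<union> H \<rightarrow> Fpow X"
    then show "f (\<Union>h\<in>F \<union> H. A h) \<le> delta_hat X (F \<union> G) + delta_hat X (G \<union> H) + (\<Sum>h\<in>F \<union> H. h (A h))"
      using half[OF F H, of f A] half[OF H F, of f A] by (auto simp: Un_commute add.commute)
  qed
qed

text \<open>Trading the set at index \<open>kappa X \<delta> y\<close> for the point
  \<open>y\<close> costs exactly the corresponding term of the sum, whence the upper bound. The
  family of singletons \<open>{y}\<close> attains it, since
  \<open>kappa X \<delta> y {y} = 0\<close>.\<close>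

lemma kappa_isometry:
  assumes A: "A \<in> Fpow X"
  shows "delta_hat X (kappa X \<delta> ` A) = \<delta> A"
proof (rule antisym)
  have F: "kappa X \<delta> ` A \<in> Fpow (adm_space X \<delta>)"
    using A kappa_adm_space by (auto simp: Fpow_iff)
  have inj: "inj_on (kappa X \<delta>) A"
    using kappa_inj_on[OF diversity_axioms] A by (auto simp: Fpow_iff intro: inj_on_subset)
  show "delta_hat X (kappa X \<delta> ` A) \<le> \<delta> A"
    unfolding delta_hat_le_iff[OF F]
  proof (intro conjI ballI)
    show "0 \<le> \<delta> A" by (rule nonneg[OF A])
    fix f B assume "f \<in> kappa X \<delta> ` A" and B: "B \<in> kappa X \<delta> ` A \<rightarrow> Fpow X"
    then obtain x where x: "x \<in> A" "f = kappa X \<delta> x" by blast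
    let ?B = "\<lambda>y. B (kappa X \<delta> y)"
    have B': "?B y \<in> Fpow X" if "y \<in> A" for y using B that by auto
    have "f (\<Union>g\<in>kappa X \<delta> ` A. B g) = \<delta> ((\<Union>y\<in>A. ?B y) \<union> {x})"
      using x B' A by (subst x(2), subst kappa_apply) (auto simp: Fpow_iff)
    also have "\<dots> \<le> \<delta> ((\<lambda>y. y) ` A \<union> {x}) + (\<Sum>y\<in>A. \<delta> (insert y (?B y)))"
      using A B' x by (intro UN_link link) (auto simp: Fpow_iff)
    also have "(\<lambda>y. y) ` A \<union> {x} = A" using x by auto
    also have "(\<Sum>y\<in>A. \<delta> (insert y (?B y))) = (\<Sum>g\<in>kappa X \<delta> ` A. g (B g))"
      using B' by (simp add: sum.reindex[OF inj] kappa_apply)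
    finally show "f (\<Union>g\<in>kappa X \<delta> ` A. B g) \<le> \<delta> A + (\<Sum>g\<in>kappa X \<delta> ` A. g (B g))" .
  qed
  show "\<delta> A \<le> delta_hat X (kappa X \<delta> ` A)"
  proof (cases "A = {}")
    case False
    then obtain x where x: "x \<in> A" by blast
    have "kappa X \<delta> x (\<Union>i\<in>A. {i}) \<le> delta_hat X (kappa X \<delta> ` A) + (\<Sum>i\<in>A. kappa X \<delta> i {i})"
      using A x by (intro delta_hat_UN F) (auto simp: Fpow_iff)
    also have "(\<Sum>i\<in>A. kappa X \<delta> i {i}) = 0"
      using A by (intro sum.neutral) (auto simp: Fpow_iff kappa_apply singleton)
    finally show ?thesis using A x by (simp add: kappa_apply insert_absorb)
  qed (simp add: empty delta_hat_def)
qed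

text \<open>An admissible function, seen as a point of the larger diversity, has itself as its
  distance function over \<open>X\<close>; this is why spaces of functions realise one-point
  extensions. The lower bound again comes from singletons.\<close>

lemma delta_hat_insert_kappa:
  assumes A: "A \<in> Fpow X" and g: "g \<in> adm_space X \<delta>"
  shows "delta_hat X (insert g (kappa X \<delta> ` A)) = g A"
proof (cases "g \<in> kappa X \<delta> ` A")
  case True
  then obtain a where "a \<in> A" "g = kappa X \<delta> a" by blast
  then show ?thesis
    using A True by (simp add: insert_absorb kappa_isometry kappa_apply)
next
  case False
  interpret g: admissible X \<delta> g by (rule adm_spaceD[OF g])
  let ?F = "insert g (kappa X \<delta> ` A)"
  have F: "?F \<in> Fpow (adm_space X \<delta>)"
    using A g kappa_adm_space by (auto simp: Fpow_iff)
  have inj: "inj_on (kappa X \<delta>) A"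
    using kappa_inj_on[OF diversity_axioms] A by (auto simp: Fpow_iff intro: inj_on_subset)
  show ?thesis
  proof (rule antisym)
    show "delta_hat X ?F \<le> g A"
      unfolding delta_hat_le_iff[OF F]
    proof (intro conjI ballI)
      show "0 \<le> g A" by (rule g.f_nonneg[OF A])
      fix f B assume f: "f \<in> ?F" and B: "B \<in> ?F \<rightarrow> Fpow X"
      let ?B = "\<lambda>y. B (kappa X \<delta> y)"
      have B': "?B y \<in> Fpow X" if "y \<in> A" for y using B that by auto
      have Bg: "B g \<in> Fpow X" using B by auto
      have U: "(\<Union>y\<in>A. ?B y) \<in> Fpow X" using B' A by (auto simp: Fpow_iff)
      have "(\<Sum>h\<in>?F. h (B h)) = g (B g) + (\<Sum>y\<in>A. kappa X \<delta> y (?B y))"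
        using A False by (simp add: Fpow_iff sum.reindex[OF inj])
      then have sum: "(\<Sum>h\<in>?F. h (B h)) = g (B g) + (\<Sum>y\<in>A. \<delta> (insert y (?B y)))"
        using B' by (simp add: kappa_apply)
      show "f (\<Union>h\<in>?F. B h) \<le> g A + (\<Sum>h\<in>?F. h (B h))"
      proof (cases "f = g")
        case True
        have "f (\<Union>h\<in>?F. B h) \<le> g (B g) + g ((\<Union>y\<in>A. ?B y) \<union> {})"
          using g.f_Un[OF Bg U] True by simp
        also have "g ((\<Union>y\<in>A. ?B y) \<union> {}) \<le> g ((\<lambda>y. y) ` A \<union> {}) + (\<Sum>y\<in>A. \<delta> (insert y (?B y)))"
          using A B' by (intro UN_link g.f_link) (auto simp: Fpow_iff)
        finally show ?thesis using sum by simp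
      next
        case False
        then obtain x where x: "x \<in> A" "f = kappa X \<delta> x" using f by blast
        have C: "insert x (B g) \<in> Fpow X" "A \<union> B g \<in> Fpow X" using A Bg x by (auto simp: Fpow_iff)
        have "f (\<Union>h\<in>?F. B h) = \<delta> ((\<Union>y\<in>A. ?B y) \<union> insert x (B g))"
          using U Bg by (subst x(2), subst kappa_apply) (auto simp: Fpow_iff Un_commute)
        also have "\<dots> \<le> \<delta> ((\<lambda>y. y) ` A \<union> insert x (B g)) + (\<Sum>y\<in>A. \<delta> (insert y (?B y)))"
          using A B' C by (intro UN_link link) (auto simp: Fpow_iff)
        also have "(\<lambda>y. y) ` A \<union> insert x (B g) = A \<union> B g" using x by auto
        \<comment> \<open>Only the set at index \<open>g\<close> is left over; \<open>f_ge\<close>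
          and \<open>f_Un\<close> split it off.\<close>
        also have "\<delta> (A \<union> B g) \<le> g A + g (B g)"
          using g.f_ge[OF C(2)] g.f_Un[OF A Bg] by simp
        finally show ?thesis using sum by simp
      qed
    qed
    have "g (\<Union>i\<in>A. {i}) \<le> delta_hat X ?F + (\<Sum>i\<in>A. kappa X \<delta> i {i})"
      using A by (intro delta_hat_UN F) (auto simp: Fpow_iff)
    also have "(\<Sum>i\<in>A. kappa X \<delta> i {i}) = 0"
      using A by (intro sum.neutral) (auto simp: Fpow_iff kappa_apply singleton)
    finally show "g A \<le> delta_hat X ?F" by simp
  qed
qed

end

section \<open>Finitely supported functions\<close>

lemma supp_extension_cong:
  assumes "\<And>B. B \<in> Fpow S \<Longrightarrow> f B = g B"
  shows "supp_extension X \<delta> S f = supp_extension X \<delta> S g"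
  unfolding supp_extension_def
  by (intro restrict_ext arg_cong[where f = Inf] Collect_cong ex_cong1) (auto simp: assms)

text \<open>\<open>f\<close> is only asked to be \<open>admissible\<close> on \<open>S\<close>,
  without extensionality, so that a function on all of \<open>X\<close> can act as its own data on
  \<open>S\<close>, as in \<open>finsuppE\<close>.\<close>

locale supported = diversity X \<delta> + S: admissible S \<delta> f
  for X :: "'a set" and \<delta> and S and f +
  assumes supp_subset: "S \<subseteq> X" and supp_nonempty: "S \<noteq> {}"
begin

abbreviation ext :: "'a set \<Rightarrow> real" where
  "ext \<equiv> supp_extension X \<delta> S f"

text \<open>\<open>ext_le\<close> and \<open>le_ext\<close> are the two halves of the infimum. Over
  the reals the first rests on the lower bound 0, the second on the existence of a decomposition,
  obtained by attaching all of \<open>A\<close> to one point of \<open>S\<close>.\<close>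

lemma ext_le:
  assumes B: "B \<in> Fpow S" and A: "(\<Union>b\<in>B. C b) = A" "A \<in> Fpow X"
  shows "ext A \<le> f B + (\<Sum>b\<in>B. \<delta> (insert b (C b)))"
proof -
  have "0 \<le> f B + (\<Sum>b\<in>B. \<delta> (insert b (C b)))" if "B \<in> Fpow S" "(\<Union>b\<in>B. C b) = A" for B C
  proof (intro add_nonneg_nonneg sum_nonneg)
    show "0 \<le> f B" by (rule S.f_nonneg) fact
    fix b assume "b \<in> B"
    then have "insert b (C b) \<subseteq> X" "finite (C b)"
      using that A(2) supp_subset by (auto simp: Fpow_iff intro: finite_subset)
    then show "0 \<le> \<delta> (insert b (C b))"
      by (intro nonneg) (simp add: Fpow_iff)
  qed
  then have "bdd_below {f B + (\<Sum>b\<in>B. \<delta> (insert b (C b))) | B C. B \<in> Fpow S \<and> (\<Union>b\<in>B. C b) = A}"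
    by (intro bdd_belowI[of _ 0]) auto
  then show ?thesis
    using A(2) unfolding supp_extension_def by (auto intro!: cInf_lower exI[of _ B] exI[of _ C] A B)
qed

lemma le_ext:
  assumes A: "A \<in> Fpow X"
    and c: "\<And>B C. B \<in> Fpow S \<Longrightarrow> (\<Union>b\<in>B. C b) = A \<Longrightarrow> c \<le> f B + (\<Sum>b\<in>B. \<delta> (insert b (C b)))"
  shows "c \<le> ext A"
proof -
  obtain s where s: "s \<in> S" using supp_nonempty by blast
  have "c \<le> Inf {f B + (\<Sum>b\<in>B. \<delta> (insert b (C b))) | B C. B \<in> Fpow S \<and> (\<Union>b\<in>B. C b) = A}"
  proof (rule cInf_greatest)
    have "{s} \<in> Fpow S" "(\<Union>b\<in>{s}. (\<lambda>_. A) b) = A"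
      using s by (auto simp: Fpow_iff)
    then show "{f B + (\<Sum>b\<in>B. \<delta> (insert b (C b))) | B C. B \<in> Fpow S \<and> (\<Union>b\<in>B. C b) = A} \<noteq> {}"
      by blast
  qed (use c in blast)
  then show ?thesis using A by (simp add: supp_extension_def)
qed

text \<open>\<open>UN_link\<close> moves every piece \<open>C b\<close> of a decomposition to its
  point \<open>b\<close>, which leaves \<open>h B \<le> f B\<close>. In view of
  \<open>ext_eq\<close> and \<open>admissible_ext\<close>, \<open>ext\<close> is thus the largest
  function that satisfies the link inequality and lies below \<open>f\<close> on
  \<open>S\<close>.\<close>

lemma le_extI:
  assumes h: "\<And>A B x. A \<in> Fpow X \<Longrightarrow> B \<in> Fpow X \<Longrightarrow> x \<in> X
                \<Longrightarrow> h (A \<union> B) \<le> h (insert x A) + \<delta> (insert x B)"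
    and "\<And>B. B \<in> Fpow S \<Longrightarrow> h B \<le> f B"
    and A: "A \<in> Fpow X"
  shows "h A \<le> ext A"
proof (rule le_ext[OF A])
  fix B C assume B: "B \<in> Fpow S" and C: "(\<Union>b\<in>B. C b) = A"
  have "h ((\<Union>b\<in>B. C b) \<union> {}) \<le> h ((\<lambda>b. b) ` B \<union> {}) + (\<Sum>b\<in>B. \<delta> (insert b (C b)))"
  proof (rule UN_link[OF h])
    show "finite B" "\<And>b. b \<in> B \<Longrightarrow> b \<in> X" using B supp_subset by (auto simp: Fpow_iff)
    fix b assume "b \<in> B"
    then have "C b \<subseteq> A" using C by blast
    then show "C b \<in> Fpow X" using A by (auto simp: Fpow_iff intro: finite_subset)
  qed (simp_all add: Fpow_iff)
  then show "h A \<le> f B + (\<Sum>b\<in>B. \<delta> (insert b (C b)))"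
    using assms(2)[OF B] C by simp
qed

text \<open>Attaching each point to itself gives a decomposition whose pieces cost nothing. For the
  other bound the argument of \<open>le_extI\<close> is repeated inside \<open>S\<close>, because
  \<open>f\<close> satisfies \<open>f_link\<close> only there.\<close>

lemma ext_eq:
  assumes A: "A \<in> Fpow S"
  shows "ext A = f A"
proof (rule antisym)
  have AX: "A \<in> Fpow X" using A supp_subset by (auto simp: Fpow_iff)
  have "(\<Sum>b\<in>A. \<delta> (insert b {b})) = 0"
    using AX by (intro sum.neutral) (auto simp: Fpow_iff singleton)
  then show "ext A \<le> f A"
    using ext_le[OF A _ AX, of "\<lambda>b. {b}"] by simp
  show "f A \<le> ext A"
  proof (rule le_ext[OF AX])
    fix B C assume B: "B \<in> Fpow S" and C: "(\<Union>b\<in>B. C b) = A"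
    have "f ((\<Union>b\<in>B. C b) \<union> {}) \<le> f ((\<lambda>b. b) ` B \<union> {}) + (\<Sum>b\<in>B. \<delta> (insert b (C b)))"
    proof (rule S.UN_link[OF S.f_link])
      show "finite B" "\<And>b. b \<in> B \<Longrightarrow> b \<in> S" using B by (auto simp: Fpow_iff)
      fix b assume "b \<in> B"
      then have "C b \<subseteq> A" using C by blast
      then show "C b \<in> Fpow S" using A by (auto simp: Fpow_iff intro: finite_subset)
    qed (simp_all add: Fpow_iff)
    then show "f A \<le> f B + (\<Sum>b\<in>B. \<delta> (insert b (C b)))"
      using C by simp
  qed
qed

text \<open>\<open>f_ge\<close> is the maximality \<open>le_extI\<close> applied to \<delta>. For
  \<open>f_Un\<close> and \<open>f_link\<close> the remaining terms are moved across, so that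
  \<open>le_ext\<close> reduces the claim to given decompositions of the sets on the right, from
  which one of \<open>A \<union> B\<close> is assembled.\<close>

lemma admissible_ext: "admissible X \<delta> ext"
proof
  show "ext {} = 0" by (simp add: ext_eq Fpow_iff S.f_empty)
next
  fix A assume A: "A \<in> Fpow X"
  show "\<delta> A \<le> ext A"
    by (rule le_extI[OF link _ A]) (auto intro: S.f_ge)
  fix B assume B: "B \<in> Fpow X"
  have AB: "A \<union> B \<in> Fpow X" using A B by (auto simp: Fpow_iff)
  have "ext (A \<union> B) - ext B \<le> ext A"
  proof (rule le_ext[OF A])
    fix D E assume D: "D \<in> Fpow S" and E: "(\<Union>b\<in>D. E b) = A"
    have "ext (A \<union> B) - (f D + (\<Sum>b\<in>D. \<delta> (insert b (E b)))) \<le> ext B"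
    proof (rule le_ext[OF B])
      fix D' E' assume D': "D' \<in> Fpow S" and E': "(\<Union>b\<in>D'. E' b) = B"
      \<comment> \<open>Both decompositions are padded with empty pieces to the common point set
        \<open>D \<union> D'\<close>, at no cost since \<open>\<delta> {b} = 0\<close>; the two
        pieces at \<open>b\<close>, each with \<open>b\<close> inserted, then overlap in
        \<open>b\<close>.\<close>
      define H H' where "H b = (if b \<in> D then E b else {})" "H' b = (if b \<in> D' then E' b else {})" for b
      have fin: "finite (D \<union> D')" "D \<union> D' \<subseteq> X"
        using D D' supp_subset by (auto simp: Fpow_iff)
      have sub: "H b \<subseteq> A" "H' b \<subseteq> B" for b
        using E E' by (auto simp: H_H'_def)
      have HX: "H b \<in> Fpow X" "H' b \<in> Fpow X" for b
        using A B sub[of b] by (auto simp: Fpow_iff intro: finite_subset)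
      have "ext (A \<union> B) \<le> f (D \<union> D') + (\<Sum>b\<in>D \<union> D'. \<delta> (insert b (H b \<union> H' b)))"
        using D D' E E' by (intro ext_le AB) (auto simp: H_H'_def Fpow_iff split: if_splits)
      also have "f (D \<union> D') \<le> f D + f D'" by (rule S.f_Un[OF D D'])
      also have "(\<Sum>b\<in>D \<union> D'. \<delta> (insert b (H b \<union> H' b)))
          \<le> (\<Sum>b\<in>D \<union> D'. \<delta> (insert b (H b)) + \<delta> (insert b (H' b)))"
      proof (rule sum_mono)
        fix b assume "b \<in> D \<union> D'"
        then show "\<delta> (insert b (H b \<union> H' b)) \<le> \<delta> (insert b (H b)) + \<delta> (insert b (H' b))"
          using overlap[of "insert b (H b)" "insert b (H' b)" b] HX[of b] fin by (auto simp: Fpow_iff)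
      qed
      also have "\<dots> = (\<Sum>b\<in>D \<union> D'. \<delta> (insert b (H b))) + (\<Sum>b\<in>D \<union> D'. \<delta> (insert b (H' b)))"
        by (rule sum.distrib)
      also have "(\<Sum>b\<in>D \<union> D'. \<delta> (insert b (H b))) = (\<Sum>b\<in>D. \<delta> (insert b (E b)))"
        using fin by (intro sum.mono_neutral_cong_right) (auto simp: H_H'_def singleton subset_iff)
      also have "(\<Sum>b\<in>D \<union> D'. \<delta> (insert b (H' b))) = (\<Sum>b\<in>D'. \<delta> (insert b (E' b)))"
        using fin by (intro sum.mono_neutral_cong_right) (auto simp: H_H'_def singleton subset_iff)
      finally show "ext (A \<union> B) - (f D + (\<Sum>b\<in>D. \<delta> (insert b (E b))))
          \<le> f D' + (\<Sum>b\<in>D'. \<delta> (insert b (E' b)))" by simp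
    qed
    then show "ext (A \<union> B) - ext B \<le> f D + (\<Sum>b\<in>D. \<delta> (insert b (E b)))" by simp
  qed
  then show "ext (A \<union> B) \<le> ext A + ext B" by simp
  fix x assume x: "x \<in> X"
  have xA: "insert x A \<in> Fpow X" using A x by (simp add: Fpow_iff)
  have "ext (A \<union> B) - \<delta> (insert x B) \<le> ext (insert x A)"
  proof (rule le_ext[OF xA])
    fix D E assume D: "D \<in> Fpow S" and E: "(\<Union>b\<in>D. E b) = insert x A"
    then obtain c where c: "c \<in> D" "x \<in> E c" by blast
    have fin: "finite D" "D \<subseteq> X" using D supp_subset by (auto simp: Fpow_iff)
    have EX: "E b \<in> Fpow X" if "b \<in> D" for b
    proof -
      have "E b \<subseteq> insert x A" using E that by blast
      then show ?thesis using xA by (auto simp: Fpow_iff intro: finite_subset)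
    qed
    \<comment> \<open>The point \<open>c\<close> is one whose piece contains \<open>x\<close>.
      Intersecting with \<open>A\<close> turns a decomposition of \<open>insert x A\<close> into one
      of \<open>A\<close>, and \<open>B\<close> is added to the piece at \<open>c\<close>, where the
      overlap in \<open>x\<close> limits the extra cost to
      \<open>\<delta> (insert x B)\<close>.\<close>
    define H where "H b = E b \<inter> A \<union> (if b = c then B else {})" for b
    have "(\<Union>b\<in>D. H b) = (\<Union>b\<in>D. E b) \<inter> A \<union> B"
      using c by (auto simp: H_def split: if_splits)
    then have "(\<Union>b\<in>D. H b) = A \<union> B" using E by auto
    then have "ext (A \<union> B) \<le> f D + (\<Sum>b\<in>D. \<delta> (insert b (H b)))"
      by (intro ext_le AB D)
    also have "(\<Sum>b\<in>D. \<delta> (insert b (H b)))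
        \<le> (\<Sum>b\<in>D. \<delta> (insert b (E b)) + (if b = c then \<delta> (insert x B) else 0))"
    proof (rule sum_mono)
      fix b assume b: "b \<in> D"
      show "\<delta> (insert b (H b)) \<le> \<delta> (insert b (E b)) + (if b = c then \<delta> (insert x B) else 0)"
      proof (cases "b = c")
        case True
        have "\<delta> (insert b (H b)) \<le> \<delta> (insert b (E b) \<union> insert x B)"
          using EX[OF b] b fin B x by (intro mono) (auto simp: H_def Fpow_iff split: if_splits)
        also have "\<dots> \<le> \<delta> (insert b (E b)) + \<delta> (insert x B)"
          using EX[OF b] b fin B x c True by (intro overlap[where x = x]) (auto simp: Fpow_iff)
        finally show ?thesis using True by simp
      next
        case False
        then show ?thesis
          using EX[OF b] b fin by (auto simp: H_def Fpow_iff intro!: mono)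
      qed
    qed
    also have "\<dots> = (\<Sum>b\<in>D. \<delta> (insert b (E b))) + \<delta> (insert x B)"
      using fin c by (simp add: sum.distrib sum.delta)
    finally show "ext (A \<union> B) - \<delta> (insert x B) \<le> f D + (\<Sum>b\<in>D. \<delta> (insert b (E b)))"
      by simp
  qed
  then show "ext (A \<union> B) \<le> ext (insert x A) + \<delta> (insert x B)" by simp
qed

lemma ext_adm_space: "ext \<in> adm_space X \<delta>"
  using admissible_ext by (simp add: adm_space_iff supp_extension_def)

end

section \<open>Membership in E(X, \<omega>)\<close>

context diversity
begin

lemma finsuppI:
  assumes "S \<in> Fpow X" "S \<noteq> {}" "f \<in> adm_space S \<delta>"
  shows "supp_extension X \<delta> S f \<in> finsupp_space X \<delta>"
    and "A \<in> Fpow S \<Longrightarrow> supp_extension X \<delta> S f A = f A"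
proof -
  interpret S: diversity S \<delta> using assms by (auto simp: Fpow_iff intro: subset)
  interpret f: admissible S \<delta> f by (rule S.adm_spaceD) fact
  interpret supported X \<delta> S f
    unfolding supported_def supported_axioms_def
    using diversity_axioms f.admissible_axioms assms by (auto simp: Fpow_iff)
  show "supp_extension X \<delta> S f \<in> finsupp_space X \<delta>"
    using assms ext_adm_space by (auto simp: finsupp_space_def)
  show "A \<in> Fpow S \<Longrightarrow> supp_extension X \<delta> S f A = f A"
    by (rule ext_eq)
qed

text \<open>The extension agrees with its data on the support, so these data are the values of
  \<open>g\<close> itself. Later proofs then handle only a support and \<open>g\<close>.\<close>

lemma finsuppE:
  assumes "g \<in> finsupp_space X \<delta>"
  obtains S where "S \<in> Fpow X" "S \<noteq> {}" "supported X \<delta> S g" "g = supp_extension X \<delta> S g"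
proof -
  obtain S f where S: "S \<in> Fpow X" "S \<noteq> {}" "f \<in> adm_space S \<delta>"
    and g: "g = supp_extension X \<delta> S f" "g \<in> adm_space X \<delta>"
    using assms by (auto simp: finsupp_space_def)
  interpret g: admissible X \<delta> g by (rule adm_spaceD[OF g(2)])
  have "admissible S \<delta> g" using S by (auto simp: Fpow_iff intro: g.admissible_subset)
  then interpret supported X \<delta> S g
    unfolding supported_def supported_axioms_def
    using diversity_axioms S by (auto simp: Fpow_iff)
  have "g B = f B" if "B \<in> Fpow S" for B
    using finsuppI(2)[OF S that] g by simp
  then have "supp_extension X \<delta> S g = supp_extension X \<delta> S f"
    by (rule supp_extension_cong)
  then show ?thesis using that[OF S(1,2) supported_axioms] g by simp
qed

end

context nonempty_diversity
begin

text \<open>The support is \<open>{x}\<close>: attaching all of \<open>A\<close> to \<open>x\<close>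
  costs \<open>\<delta> (insert x A)\<close>, and \<open>le_extI\<close> excludes smaller
  values.\<close>

lemma kappa_finsupp:
  assumes x: "x \<in> X"
  shows "kappa X \<delta> x \<in> finsupp_space X \<delta>"
proof -
  interpret k: admissible X \<delta> "kappa X \<delta> x"
    by (rule adm_spaceD[OF kappa_adm_space[OF x]])
  have S: "{x} \<in> Fpow X" "{x} \<noteq> {}" using x by (auto simp: Fpow_iff)
  interpret supported X \<delta> "{x}" "kappa X \<delta> x"
    unfolding supported_def supported_axioms_def
    using diversity_axioms k.admissible_subset[of "{x}"] x by simp
  let ?f = "restrict (kappa X \<delta> x) (Fpow {x})"
  have "kappa X \<delta> x = ext"
  proof (rule adm_space_eqI[OF kappa_adm_space[OF x] ext_adm_space])
    fix A assume A: "A \<in> Fpow X"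
    have "ext A \<le> kappa X \<delta> x {x} + (\<Sum>b\<in>{x}. \<delta> (insert b A))"
      using A by (intro ext_le) (auto simp: Fpow_iff)
    then have "ext A \<le> kappa X \<delta> x A"
      using A x S by (simp add: kappa_apply singleton)
    moreover have "kappa X \<delta> x A \<le> ext A"
      by (rule le_extI[OF k.f_link _ A]) auto
    ultimately show "kappa X \<delta> x A = ext A" by simp
  qed
  also have "ext = supp_extension X \<delta> {x} ?f"
    by (rule supp_extension_cong) simp
  also have "\<dots> \<in> finsupp_space X \<delta>"
    using S x by (intro finsuppI k.restrict_adm_space) auto
  finally show ?thesis .
qed

text \<open>The finitely supported extension of \<open>f\<close> agrees with \<open>f\<close> on
  subsets of \<open>F\<close>, and by \<open>delta_hat_insert_kappa\<close> these values are its
  diversities with the points of \<open>F\<close>.\<close>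

lemma finsupp_extension:
  assumes F: "F \<in> Fpow X" and f: "f \<in> adm_space F \<delta>"
  shows "\<exists>g\<in>finsupp_space X \<delta>. \<forall>A\<subseteq>F. f A = delta_hat X (insert g (kappa X \<delta> ` A))"
proof (cases "F = {}")
  \<comment> \<open>A support must be nonempty, so this case is separate: only
    \<open>f {} = 0\<close> is asked for, and the image of any point of \<open>X\<close>
    serves.\<close>
  case True
  interpret F: diversity F \<delta> using F by (auto simp: Fpow_iff intro: subset)
  obtain x where x: "x \<in> X" using nonempty by blast
  have "f {} = 0" using F.adm_spaceD[OF f] by (rule admissible.f_empty)
  then show ?thesis
    using True kappa_finsupp[OF x] by (auto simp: delta_hat_def)
next
  case False
  let ?g = "supp_extension X \<delta> F f"
  have g: "?g \<in> finsupp_space X \<delta>" by (rule finsuppI[OF F False f])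
  have "f A = delta_hat X (insert ?g (kappa X \<delta> ` A))" if "A \<subseteq> F" for A
  proof -
    have "A \<in> Fpow F" "A \<in> Fpow X" using F that by (auto simp: Fpow_iff intro: finite_subset)
    then show ?thesis
      using finsuppI(2)[OF F False f] g by (subst delta_hat_insert_kappa) (auto simp: finsupp_space_def)
  qed
  with g show ?thesis by blast
qed

text \<open>
  Each point \<open>s\<close> of the support of \<open>g\<close> is moved to a nearby point \<open>u s\<close> of \<open>D\<close>, and \<open>h\<close> is
  the extension of the restriction of \<open>g\<close> to the new support; \<open>u\<close> need not be injective.
\<close>

lemma finsupp_approx:
  assumes g: "g \<in> finsupp_space X \<delta>" and D: "D \<subseteq> X" "\<And>x e. x \<in> X \<Longrightarrow> 0 < e \<Longrightarrow> \<exists>c\<in>D. \<delta> {x, c} < e"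
    and e: "0 < e"
  shows "\<exists>S h. S \<in> Fpow D \<and> S \<noteq> {} \<and> h \<in> finsupp_space X \<delta> \<and> supported X \<delta> S h \<and> h = supp_extension X \<delta> S h
    \<and> (\<forall>A\<in>Fpow X. \<bar>g A - h A\<bar> < e)"
proof -
  from g obtain S where S: "S \<in> Fpow X" "S \<noteq> {}" "supported X \<delta> S g" and gS: "g = supp_extension X \<delta> S g"
    by (rule finsuppE)
  interpret g: supported X \<delta> S g by fact
  interpret gX: admissible X \<delta> g using g by (auto simp: finsupp_space_def intro: adm_spaceD)
  \<comment> \<open>The error will be twice the sum of the displacements
    \<open>\<delta> {b, u b}\<close>, hence at most \<open>2 * card S * \<epsilon>\<close>; the
    summand 1 makes this strictly less than \<open>e\<close>.\<close>
  define \<epsilon> where "\<epsilon> = e / (2 * real (card S) + 1)"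
  have \<epsilon>: "0 < \<epsilon>" "2 * real (card S) * \<epsilon> < e"
    using e by (auto simp: \<epsilon>_def field_simps)
  have "\<forall>s\<in>S. \<exists>c\<in>D. \<delta> {s, c} < \<epsilon>"
    using S(1) D \<epsilon> by (auto simp: Fpow_iff)
  then obtain u where u: "\<And>s. s \<in> S \<Longrightarrow> u s \<in> D" "\<And>s. s \<in> S \<Longrightarrow> \<delta> {s, u s} < \<epsilon>"
    by metis
  let ?T = "u ` S"
  let ?f = "restrict g (Fpow ?T)"
  let ?h = "supp_extension X \<delta> ?T ?f"
  have T: "?T \<in> Fpow X" "?T \<noteq> {}" "?T \<in> Fpow D"
    using S u D by (auto simp: Fpow_iff)
  have f: "?f \<in> adm_space ?T \<delta>"
    using T by (intro gX.restrict_adm_space) (auto simp: Fpow_iff)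
  have h: "?h \<in> finsupp_space X \<delta>" "\<And>B. B \<in> Fpow ?T \<Longrightarrow> ?h B = g B"
    using finsuppI[OF T(1,2) f] by auto
  interpret hX: admissible X \<delta> ?h using h by (auto simp: finsupp_space_def intro: adm_spaceD)
  interpret h: supported X \<delta> ?T ?f
  proof -
    interpret T: diversity ?T \<delta> using T by (auto simp: Fpow_iff intro: subset)
    show "supported X \<delta> ?T ?f"
      unfolding supported_def supported_axioms_def
      using diversity_axioms T.adm_spaceD[OF f] T by (auto simp: Fpow_iff)
  qed
  have hh: "?h = supp_extension X \<delta> ?T ?h"
    using h(2) by (intro supp_extension_cong) simp
  have hsupp: "supported X \<delta> ?T ?h"
    unfolding supported_def supported_axioms_def
    using diversity_axioms hX.admissible_subset T by (auto simp: Fpow_iff)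
  have "\<bar>g A - ?h A\<bar> < e" if A: "A \<in> Fpow X" for A
  proof -
    \<comment> \<open>No error arises on this side: \<open>g\<close> agrees with the data of
      \<open>?h\<close> on the new support, and \<open>?h\<close> is the largest such
      extension.\<close>
    have "g A \<le> ?h A"
      by (rule h.le_extI[OF gX.f_link _ A]) auto
    moreover have "?h A - 2 * real (card S) * \<epsilon> \<le> supp_extension X \<delta> S g A"
    proof (rule g.le_ext[OF A])
      fix B C assume B: "B \<in> Fpow S" and C: "(\<Union>b\<in>B. C b) = A"
      have BX: "finite B" "B \<subseteq> X" "B \<subseteq> S" using B S by (auto simp: Fpow_iff)
      have uX: "u b \<in> X" if "b \<in> B" for b using that BX(3) u(1) D(1) by blast
      have CX: "C b \<in> Fpow X" if "b \<in> B" for b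
      proof -
        have "C b \<subseteq> A" using C that by blast
        then show ?thesis using A by (auto simp: Fpow_iff intro: finite_subset)
      qed
      have "(\<Sum>b\<in>B. \<delta> {b, u b}) \<le> (\<Sum>b\<in>B. \<epsilon>)"
        using u(2) BX(3) by (meson less_imp_le subsetD sum_mono)
      also have "\<dots> \<le> real (card S) * \<epsilon>"
        using BX S card_mono[of S B] \<epsilon> by (auto simp: Fpow_iff intro: mult_right_mono)
      finally have small: "(\<Sum>b\<in>B. \<delta> {b, u b}) \<le> real (card S) * \<epsilon>" .
      \<comment> \<open>The displacement is paid twice: for replacing \<open>b\<close> by
        \<open>u b\<close> in the argument of \<open>g\<close>, and for replacing it in the sets
        \<open>insert b (C b)\<close>.\<close>
      have "?h ((\<Union>b\<in>B. C b) \<union> {}) \<le> ?h (u ` B \<union> {}) + (\<Sum>b\<in>B. \<delta> (insert (u b) (C b)))"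
        using BX CX uX by (intro UN_link hX.f_link) (auto simp: Fpow_iff)
      also have "?h (u ` B \<union> {}) = g ((\<Union>b\<in>B. {u b}) \<union> {})"
        using h(2)[of "u ` B"] BX by (auto simp: Fpow_iff UNION_singleton_eq_range)
      also have "g ((\<Union>b\<in>B. {u b}) \<union> {}) \<le> g ((\<lambda>b. b) ` B \<union> {}) + (\<Sum>b\<in>B. \<delta> {b, u b})"
        using BX uX by (intro UN_link gX.f_link) (auto simp: Fpow_iff)
      also have "(\<Sum>b\<in>B. \<delta> (insert (u b) (C b))) \<le> (\<Sum>b\<in>B. \<delta> {b, u b} + \<delta> (insert b (C b)))"
      proof (rule sum_mono)
        fix b assume b: "b \<in> B"
        show "\<delta> (insert (u b) (C b)) \<le> \<delta> {b, u b} + \<delta> (insert b (C b))"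
          using link[of "{u b}" "C b" b] CX[OF b] uX[OF b] BX b by (auto simp: Fpow_iff)
      qed
      also have "\<dots> = (\<Sum>b\<in>B. \<delta> {b, u b}) + (\<Sum>b\<in>B. \<delta> (insert b (C b)))"
        by (rule sum.distrib)
      finally have "?h A \<le> g B + (\<Sum>b\<in>B. \<delta> (insert b (C b))) + 2 * (\<Sum>b\<in>B. \<delta> {b, u b})"
        unfolding C Un_empty_right image_ident by linarith
      then show "?h A - 2 * real (card S) * \<epsilon> \<le> g B + (\<Sum>b\<in>B. \<delta> (insert b (C b)))"
        using small by simp
    qed
    ultimately show ?thesis using \<epsilon> gS by auto
  qed
  then show ?thesis using T h(1) hh hsupp by blast
qed

text \<open>The data enter each sum of the infimum once, so an error \<open>c\<close> in them is
  passed on without amplification.\<close>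

lemma ext_le_ext:
  assumes "supported X \<delta> S g" "supported X \<delta> S h"
    and c: "\<And>B. B \<in> Fpow S \<Longrightarrow> g B \<le> h B + c" and A: "A \<in> Fpow X"
  shows "supp_extension X \<delta> S g A \<le> supp_extension X \<delta> S h A + c"
proof -
  interpret g: supported X \<delta> S g by fact
  interpret h: supported X \<delta> S h by fact
  have "supp_extension X \<delta> S g A - c \<le> supp_extension X \<delta> S h A"
  proof (rule h.le_ext[OF A])
    fix B C assume B: "B \<in> Fpow S" and C: "(\<Union>b\<in>B. C b) = A"
    show "supp_extension X \<delta> S g A - c \<le> h B + (\<Sum>b\<in>B. \<delta> (insert b (C b)))"
      using g.ext_le[OF B C A] c[OF B] by simp
  qed
  then show ?thesis by simp
qed

lemma finsupp_separable:
  assumes D: "countable D" "D \<subseteq> X" "\<And>x e. x \<in> X \<Longrightarrow> 0 < e \<Longrightarrow> \<exists>c\<in>D. \<delta> {x, c} < e"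
  shows "\<exists>C. countable C \<and> C \<subseteq> finsupp_space X \<delta> \<and>
    (\<forall>g\<in>finsupp_space X \<delta>. \<forall>e>0. \<exists>h\<in>C. delta_hat X {g, h} < e)"
proof -
  define K where "K = (SIGMA S:Fpow D. (Fpow S \<rightarrow>\<^sub>E (\<rat> :: real set)) \<times> (UNIV :: nat set))"
  \<comment> \<open>A rational approximation \<open>q\<close> is in general not admissible, so a
    code \<open>(S, q, n)\<close> does not name a function directly. Instead, one function supported
    on \<open>S\<close> and within \<open>1 / (n + 1)\<close> of \<open>q\<close> there is selected
    wherever one exists.\<close>
  define P where "P = (\<lambda>(S, q :: 'a set \<Rightarrow> real, n :: nat) h. h \<in> finsupp_space X \<delta> \<and> supported X \<delta> S h \<and>
    h = supp_extension X \<delta> S h \<and> (\<forall>A\<in>Fpow S. \<bar>h A - q A\<bar> < inverse (real (Suc n))))"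
  define C where "C = (\<lambda>k. SOME h. P k h) ` {k \<in> K. \<exists>h. P k h}"
  have "countable K"
    unfolding K_def
  proof (intro countable_SIGMA countable_PiE countable_rat countableI_type)
    show "countable (Fpow D)"
      using countable_Collect_finite_subset[OF D(1)] by (simp add: Fpow_def conj_commute)
    show "finite (Fpow S)" if "S \<in> Fpow D" for S
      using that by (auto simp: Fpow_def intro: finite_subset[of _ "Pow S"])
  qed
  then have "countable C" by (simp add: C_def countable_subset[of _ K])
  moreover have "P k (SOME h. P k h)" if "\<exists>h. P k h" for k
    using that by (rule someI_ex)
  then have "C \<subseteq> finsupp_space X \<delta>"
    by (fastforce simp: C_def P_def)
  moreover have "\<exists>h\<in>C. delta_hat X {g, h} < e" if g: "g \<in> finsupp_space X \<delta>" and e: "0 < e" for g e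
  proof -
    \<comment> \<open>The error budget is \<open>e / 4\<close> for moving the support into
      \<open>D\<close>, and twice \<open>inverse (real (Suc n)) < e / 4\<close> for passing from
      \<open>g'\<close> to \<open>h\<close> by way of \<open>q\<close>.\<close>
    obtain S g' where S: "S \<in> Fpow D" and g': "g' \<in> finsupp_space X \<delta>" "supported X \<delta> S g'"
      "g' = supp_extension X \<delta> S g'" and gg': "\<And>A. A \<in> Fpow X \<Longrightarrow> \<bar>g A - g' A\<bar> < e / 4"
      using finsupp_approx[OF g D(2,3), of "e / 4"] e by auto
    obtain n where n: "inverse (real (Suc n)) < e / 4"
      using reals_Archimedean[of "e / 4"] e by auto
    have "\<exists>r\<in>\<rat>. \<bar>g' A - r\<bar> < inverse (real (Suc n))" for A
    proof -
      obtain r where "r \<in> \<rat>" "g' A < r" "r < g' A + inverse (real (Suc n))"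
        using Rats_dense_in_real[of "g' A" "g' A + inverse (real (Suc n))"] by auto
      then show ?thesis by (intro bexI[of _ r]) auto
    qed
    then obtain q where q: "\<And>A. q A \<in> \<rat>" "\<And>A. \<bar>g' A - q A\<bar> < inverse (real (Suc n))"
      by metis
    define k where "k = (S, restrict q (Fpow S), n)"
    have "k \<in> K" using S q by (auto simp: k_def K_def)
    moreover have "P k g'" using g' q by (simp add: k_def P_def)
    ultimately have hC: "(SOME h. P k h) \<in> C"
      by (auto simp: C_def)
    have "P k (SOME h. P k h)"
      using someI[of "P k", OF \<open>P k g'\<close>] .
    with hC obtain h where h: "h \<in> C" "h \<in> finsupp_space X \<delta>" "supported X \<delta> S h" "h = supp_extension X \<delta> S h"
      and hq: "\<And>A. A \<in> Fpow S \<Longrightarrow> \<bar>h A - q A\<bar> < inverse (real (Suc n))"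
      unfolding P_def k_def by auto
    have close: "g' B \<le> h B + e / 2" "h B \<le> g' B + e / 2" if "B \<in> Fpow S" for B
      using hq[OF that] q(2)[of B] n by linarith+
    have hg': "\<bar>h A - g' A\<bar> \<le> e / 2" if A: "A \<in> Fpow X" for A
    proof -
      have "g' A \<le> h A + e / 2"
        using ext_le_ext[OF g'(2) h(3) close(1) A] by (simp flip: g'(3) h(4))
      moreover have "h A \<le> g' A + e / 2"
        using ext_le_ext[OF h(3) g'(2) close(2) A] by (simp flip: g'(3) h(4))
      ultimately show ?thesis by linarith
    qed
    have "delta_hat X {g, h} \<le> 3 * e / 4"
    proof (rule delta_hat_pair_le)
      show "g \<in> adm_space X \<delta>" "h \<in> adm_space X \<delta>" using g h by (auto simp: finsupp_space_def)
      fix A assume "A \<in> Fpow X"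
      then show "\<bar>g A - h A\<bar> \<le> 3 * e / 4"
        using gg'[of A] hg'[of A] by linarith
    qed
    then show ?thesis using h(1) e by (intro bexI[of _ h]) auto
  qed
  ultimately show ?thesis by blast
qed

end

section \<open>The tower\<close>

lemma (in diversity) induced_metric_eq: "x \<in> X \<Longrightarrow> y \<in> X \<Longrightarrow> induced_metric X \<delta> x y = \<delta> {x, y}"
  by (simp add: induced_metric_def)

lemma (in diversity) separable_diversity_iff:
  "separable_diversity X \<delta> \<longleftrightarrow>
     (\<exists>C. countable C \<and> C \<subseteq> X \<and> (\<forall>x\<in>X. \<forall>e>0. \<exists>c\<in>C. \<delta> {x, c} < e))"
proof -
  interpret M: Metric_space X "induced_metric X \<delta>" by (rule Metric_space)
  have "M.mtopology closure_of C = X \<longleftrightarrow> (\<forall>x\<in>X. \<forall>e>0. \<exists>c\<in>C. \<delta> {x, c} < e)" if "C \<subseteq> X" for C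
    using that induced_metric_eq unfolding M.metric_closure_of M.in_mball set_eq_iff
    by (smt (verit, best) mem_Collect_eq subsetD)
  then show ?thesis
    using diversity_axioms by (auto simp: separable_diversity_def separable_space_def)
qed

lemma (in nonempty_diversity) separable_finsupp_space:
  assumes "separable_diversity X \<delta>"
  shows "separable_diversity (finsupp_space X \<delta>) (delta_hat X)"
proof -
  interpret E: diversity "finsupp_space X \<delta>" "delta_hat X"
    by (rule diversity.subset[OF diversity_delta_hat]) (auto simp: finsupp_space_def)
  show ?thesis
    using assms finsupp_separable unfolding separable_diversity_iff E.separable_diversity_iff by metis
qed

lemma finite_subset_incseq:
  fixes S :: "nat \<Rightarrow> 'a set"
  assumes "finite A" "A \<subseteq> (\<Union>n. S n)" "incseq S"
  shows "\<exists>n. A \<subseteq> S n"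
  using assms(1,2)
proof induction
  case (insert a A)
  then obtain m n where "A \<subseteq> S m" "a \<in> S n" by blast
  then have "insert a A \<subseteq> S (max m n)"
    using monoD[OF \<open>incseq S\<close>, of m "max m n"] monoD[OF \<open>incseq S\<close>, of n "max m n"] by auto
  then show ?case ..
qed simp

section \<open>Passage from one stage of the tower to the next\<close>

abbreviation "tower_carrier n \<equiv> fst (tower n)"
abbreviation "tower_delta n \<equiv> snd (tower n)"
abbreviation "tower_embedding n \<equiv> tower_code n (tower_carrier n) (tower_delta n)"

lemma tower_carrier_Suc:
  "tower_carrier (Suc n) = tower_embedding n ` finsupp_space (tower_carrier n) (tower_delta n)"
  by (simp add: tower_step_def split: prod.splits)

lemma tower_iso_Suc:
  "diversity_iso (finsupp_space (tower_carrier n) (tower_delta n)) (delta_hat (tower_carrier n))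
     (tower_carrier (Suc n)) (tower_delta (Suc n)) (tower_embedding n)"
proof -
  have inj: "inj_on (tower_embedding n) (finsupp_space (tower_carrier n) (tower_delta n))"
    by (rule inj_on_tower_code) simp
  have "tower_delta (Suc n) A = delta_hat (tower_carrier n)
      (inv_into (finsupp_space (tower_carrier n) (tower_delta n)) (tower_embedding n) ` A)" for A
    by (simp add: tower_step_def split: prod.splits)
  then show ?thesis
    using inj by (simp add: diversity_iso_def bij_betw_def tower_carrier_Suc inv_into_image_cancel
        Fpow_iff del: tower.simps)
qed

lemma tower_nonempty_separable:
  "nonempty_diversity (tower_carrier n) (tower_delta n) \<and>
   separable_diversity (tower_carrier n) (tower_delta n)"
proof (induction n)
  case 0
  have card: "card A \<le> 1" if "A \<in> Fpow {(0 :: nat, 0 :: real)}" for A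
    using that card_mono[of "{(0, 0)}" A] by (simp add: Fpow_iff)
  interpret nonempty_diversity "{(0 :: nat, 0 :: real)}" "\<lambda>_. 0"
    by unfold_locales (use card in auto)
  show ?case
    using nonempty_diversity_axioms separable_diversity_iff
    by (auto intro!: exI[of _ "{(0, 0)}"])
next
  case (Suc n)
  then interpret nonempty_diversity "tower_carrier n" "tower_delta n" by simp
  have "separable_diversity (tower_carrier (Suc n)) (tower_delta (Suc n))"
    using separable_diversity_iso[OF separable_finsupp_space tower_iso_Suc] Suc by blast
  moreover have "tower_carrier (Suc n) \<noteq> {}"
    unfolding tower_carrier_Suc using kappa_finsupp nonempty by blast
  ultimately show ?case
    by (simp add: nonempty_diversity_def nonempty_diversity_axioms_def separable_diversity_def)
qed

lemmas tower_diversity = tower_nonempty_separable[THEN conjunct1]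

lemma tower_embedding_kappa:
  assumes "x \<in> tower_carrier n"
  shows "tower_embedding n (kappa (tower_carrier n) (tower_delta n) x) = x"
  using assms tower_diversity[of n] by (intro tower_code_kappa) (simp_all add: nonempty_diversity_def)

text \<open>Points of the new stage are given as functions in \<open>G\<close>, those of the old
  stage as themselves in \<open>A\<close>; \<open>kappa\<close> turns the latter into functions and
  \<open>tower_embedding\<close> undoes this. \<open>G = {}\<close> yields the compatibility of the
  stages, \<open>G = {g}\<close> the extension property.\<close>

lemma tower_delta_Suc:
  assumes g: "G \<in> Fpow (finsupp_space (tower_carrier n) (tower_delta n))"
    and A: "A \<in> Fpow (tower_carrier n)"
  shows "tower_delta (Suc n) (tower_embedding n ` G \<union> A)
    = delta_hat (tower_carrier n) (G \<union> kappa (tower_carrier n) (tower_delta n) ` A)"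
proof -
  interpret nonempty_diversity "tower_carrier n" "tower_delta n" by (rule tower_diversity)
  let ?k = "kappa (tower_carrier n) (tower_delta n)"
  have "tower_embedding n ` ?k ` A = A"
    using A tower_embedding_kappa by (force simp: Fpow_iff image_image)
  moreover have "G \<union> ?k ` A \<in> Fpow (finsupp_space (tower_carrier n) (tower_delta n))"
    using g A kappa_finsupp by (auto simp: Fpow_iff)
  ultimately show ?thesis
    using tower_iso_Suc[of n] unfolding diversity_iso_def by (metis image_Un)
qed

lemma tower_carrier_subset_Suc: "tower_carrier n \<subseteq> tower_carrier (Suc n)"
proof
  interpret nonempty_diversity "tower_carrier n" "tower_delta n" by (rule tower_diversity)
  fix x assume "x \<in> tower_carrier n"
  then show "x \<in> tower_carrier (Suc n)"
    unfolding tower_carrier_Suc using kappa_finsupp tower_embedding_kappa by (metis imageI)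
qed

lemma incseq_tower_carrier: "incseq tower_carrier"
  by (intro incseq_SucI tower_carrier_subset_Suc)

lemma tower_delta_le:
  assumes "m \<le> n" "A \<in> Fpow (tower_carrier m)"
  shows "tower_delta n A = tower_delta m A"
  using assms(1)
proof (induction rule: dec_induct)
  case (step n)
  interpret nonempty_diversity "tower_carrier n" "tower_delta n" by (rule tower_diversity)
  have A: "A \<in> Fpow (tower_carrier n)"
    using assms(2) monoD[OF incseq_tower_carrier step(1)] by (auto simp: Fpow_iff)
  then show ?case
    using tower_delta_Suc[of "{}" n A] kappa_isometry[OF A] step.IH by (simp add: Fpow_iff)
qed simp

section \<open>The direct limit of the stages\<close>

lemma tower_union_delta_eq:
  assumes A: "A \<in> Fpow (tower_carrier n)"
  shows "tower_union_delta A = tower_delta n A"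
proof -
  define m where "m = (LEAST m. A \<subseteq> tower_carrier m)"
  have "m \<le> n" "A \<subseteq> tower_carrier m"
    using A LeastI[of "\<lambda>m. A \<subseteq> tower_carrier m" n] Least_le[of "\<lambda>m. A \<subseteq> tower_carrier m" n]
    by (auto simp: m_def Fpow_iff)
  then show ?thesis
    using A tower_delta_le[of m n A] by (simp add: tower_union_delta_def m_def Fpow_iff)
qed

lemma Fpow_tower_unionE:
  assumes "A \<in> Fpow tower_union"
  obtains n where "A \<in> Fpow (tower_carrier n)"
  using assms finite_subset_incseq[OF _ _ incseq_tower_carrier, of A]
  by (auto simp: Fpow_iff tower_union_def)

lemma tower_union_subset: "tower_carrier n \<subseteq> tower_union"
  by (auto simp: tower_union_def)

lemma diversity_tower_union: "diversity tower_union tower_union_delta"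
proof
  fix A assume "A \<in> Fpow tower_union"
  then obtain n where A: "A \<in> Fpow (tower_carrier n)" by (rule Fpow_tower_unionE)
  interpret nonempty_diversity "tower_carrier n" "tower_delta n" by (rule tower_diversity)
  show "0 \<le> tower_union_delta A" "tower_union_delta A = 0 \<longleftrightarrow> card A \<le> 1"
    using nonneg[OF A] zero_iff[OF A] by (simp_all add: tower_union_delta_eq[OF A])
next
  fix A B C assume ABC: "A \<in> Fpow tower_union" "B \<in> Fpow tower_union" "C \<in> Fpow tower_union"
    and "B \<noteq> {}"
  then have "A \<union> B \<union> C \<in> Fpow tower_union" by (auto simp: Fpow_iff)
  then obtain n where "A \<union> B \<union> C \<in> Fpow (tower_carrier n)" by (rule Fpow_tower_unionE)
  then have n: "A \<in> Fpow (tower_carrier n)" "B \<in> Fpow (tower_carrier n)" "C \<in> Fpow (tower_carrier n)"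
    "A \<union> C \<in> Fpow (tower_carrier n)" "A \<union> B \<in> Fpow (tower_carrier n)" "B \<union> C \<in> Fpow (tower_carrier n)"
    by (auto simp: Fpow_iff)
  interpret nonempty_diversity "tower_carrier n" "tower_delta n" by (rule tower_diversity)
  show "tower_union_delta (A \<union> C) \<le> tower_union_delta (A \<union> B) + tower_union_delta (B \<union> C)"
    using triangle[OF n(1-3) \<open>B \<noteq> {}\<close>] by (simp add: tower_union_delta_eq[of _ n] n)
qed

lemma separable_tower_union: "separable_diversity tower_union tower_union_delta"
proof -
  interpret T: diversity tower_union tower_union_delta by (rule diversity_tower_union)
  have "\<exists>C. countable C \<and> C \<subseteq> tower_carrier n \<and>
      (\<forall>x\<in>tower_carrier n. \<forall>e>0. \<exists>c\<in>C. tower_delta n {x, c} < e)" for n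
    using tower_nonempty_separable[of n] diversity.separable_diversity_iff[of "tower_carrier n" "tower_delta n"]
    by (simp add: separable_diversity_def)
  then obtain C where C: "\<And>n. countable (C n)" "\<And>n. C n \<subseteq> tower_carrier n"
    "\<And>n x e. x \<in> tower_carrier n \<Longrightarrow> 0 < e \<Longrightarrow> \<exists>c\<in>C n. tower_delta n {x, c} < e"
    by metis
  show ?thesis
    unfolding T.separable_diversity_iff
  proof (intro exI[of _ "\<Union>n. C n"] conjI ballI allI impI)
    show "countable (\<Union>n. C n)" using C(1) by blast
    show "(\<Union>n. C n) \<subseteq> tower_union" using C(2) tower_union_subset by blast
    fix x and e :: real assume "x \<in> tower_union" "0 < e"
    then obtain n where n: "x \<in> tower_carrier n" by (auto simp: tower_union_def)
    then obtain c where c: "c \<in> C n" "tower_delta n {x, c} < e"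
      using C(3) \<open>0 < e\<close> by blast
    moreover have "tower_union_delta {x, c} = tower_delta n {x, c}"
      using n c C(2) by (intro tower_union_delta_eq) (auto simp: Fpow_iff)
    ultimately show "\<exists>c\<in>\<Union>n. C n. tower_union_delta {x, c} < e" by (metis UN_I UNIV_I)
  qed
qed

lemma adm_space_cong:
  assumes "\<And>A. A \<in> Fpow X \<Longrightarrow> \<delta> A = \<rho> A"
  shows "adm_space X \<delta> = adm_space X \<rho>"
  using assms by (simp add: adm_space_def adm_fun_def)

lemma extension_property_tower_union: "extension_property tower_union tower_union_delta"
  unfolding extension_property_def
proof (intro ballI)
  fix F f assume "F \<in> Fpow tower_union" and f: "f \<in> adm_space F tower_union_delta"
  then obtain n where F: "F \<in> Fpow (tower_carrier n)" by (blast elim: Fpow_tower_unionE)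
  interpret nonempty_diversity "tower_carrier n" "tower_delta n" by (rule tower_diversity)
  have "adm_space F tower_union_delta = adm_space F (tower_delta n)"
    using F by (intro adm_space_cong tower_union_delta_eq) (auto simp: Fpow_iff)
  with f obtain g where g: "g \<in> finsupp_space (tower_carrier n) (tower_delta n)"
    and fg: "\<And>A. A \<subseteq> F \<Longrightarrow> f A = delta_hat (tower_carrier n) (insert g (kappa (tower_carrier n) (tower_delta n) ` A))"
    using finsupp_extension[OF F] by blast
  let ?x = "tower_embedding n g"
  have x: "?x \<in> tower_carrier (Suc n)" unfolding tower_carrier_Suc using g by blast
  have "f A = tower_union_delta (insert ?x A)" if "A \<subseteq> F" for A
  proof -
    have A: "A \<in> Fpow (tower_carrier n)" using F that by (auto simp: Fpow_iff intro: finite_subset)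
    then have "insert ?x A \<in> Fpow (tower_carrier (Suc n))"
      using x tower_carrier_subset_Suc by (auto simp: Fpow_iff)
    then have "tower_union_delta (insert ?x A) = tower_delta (Suc n) (insert ?x A)"
      by (rule tower_union_delta_eq)
    then show ?thesis
      using tower_delta_Suc[of "{g}" n A] A g fg[OF that] by (simp add: Fpow_iff)
  qed
  then show "\<exists>x\<in>tower_union. \<forall>A\<subseteq>F. f A = tower_union_delta (insert x A)"
    using x tower_union_subset by blast
qed

section \<open>Back and forth\<close>

text \<open>A partial isomorphism is kept as a relation: taking the converse exchanges the two
  sides, so one extension lemma serves both directions, and unions of chains are immediate. Between
  diversities, preservation on pairs forces the relation to be the graph of an injective map, by
  (D1).\<close>

definition iso_graph ::
  "'a set \<Rightarrow> ('a set \<Rightarrow> real) \<Rightarrow> 'b set \<Rightarrow> ('b set \<Rightarrow> real) \<Rightarrow> ('a \<times> 'b) set \<Rightarrow> bool" where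
  "iso_graph X \<delta> Y \<rho> R \<longleftrightarrow> R \<subseteq> X \<times> Y \<and> (\<forall>Q\<in>Fpow R. \<delta> (fst ` Q) = \<rho> (snd ` Q))"

lemma iso_graph_converse:
  assumes "iso_graph X \<delta> Y \<rho> R"
  shows "iso_graph Y \<rho> X \<delta> (R\<inverse>)"
  unfolding iso_graph_def
proof (intro conjI ballI)
  show "R\<inverse> \<subseteq> Y \<times> X" using assms by (auto simp: iso_graph_def)
  fix Q assume "Q \<in> Fpow (R\<inverse>)"
  then have "Q\<inverse> \<in> Fpow R" by (auto simp: Fpow_iff)
  moreover have "fst ` (Q\<inverse>) = snd ` Q" "snd ` (Q\<inverse>) = fst ` Q" by force+
  ultimately show "\<rho> (fst ` Q) = \<delta> (snd ` Q)" using assms unfolding iso_graph_def by metis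
qed

locale diversity_pair = X: diversity X \<delta> + Y: diversity Y \<rho>
  for X :: "'a set" and \<delta> and Y :: "'b set" and \<rho>
begin

text \<open>The distance function of \<open>x\<close> is transported through \<open>R\<close>, with
  \<open>D B\<close> collecting the partners of the points of \<open>B\<close>. It is admissible on
  the range of \<open>R\<close> because \<delta> and \<rho> agree along \<open>R\<close>, and the
  extension property of \<open>Y\<close> supplies a point realising it.\<close>

lemma iso_graph_extend:
  assumes R: "iso_graph X \<delta> Y \<rho> R" "finite R" and ext: "extension_property Y \<rho>" and x: "x \<in> X"
  shows "\<exists>y. iso_graph X \<delta> Y \<rho> (insert (x, y) R)"
proof -
  define D where "D B = fst ` {q \<in> R. snd q \<in> B}" for B
  have D_Un: "D (B \<union> C) = D B \<union> D C" and D_insert: "D (insert b B) = D {b} \<union> D B"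
    and D_empty: "D {} = {}" for B C b
    by (auto simp: D_def)
  have Dfin: "D B \<in> Fpow X" for B
    using R by (auto simp: D_def iso_graph_def Fpow_iff)
  have Dne: "D {b} \<noteq> {}" if "b \<in> snd ` R" for b
    using that by (auto simp: D_def)
  have D_delta: "\<delta> (D B) = \<rho> B" if "B \<subseteq> snd ` R" for B
  proof -
    have "snd ` {q \<in> R. snd q \<in> B} = B" using that by force
    moreover have "{q \<in> R. snd q \<in> B} \<in> Fpow R" using R by (simp add: Fpow_iff)
    ultimately show ?thesis using R unfolding iso_graph_def D_def by metis
  qed
  define f where "f B = \<delta> (insert x (D B))" for B
  have F: "snd ` R \<in> Fpow Y" using R by (auto simp: iso_graph_def Fpow_iff)
  interpret F: diversity "snd ` R" \<rho> using F by (auto simp: Fpow_iff intro: Y.subset)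
  interpret k: admissible X \<delta> "\<lambda>A. \<delta> (insert x A)" by (rule X.admissible_insert[OF x])
  interpret f: admissible "snd ` R" \<rho> f
  proof
    show "f {} = 0" using k.f_empty by (simp add: f_def D_empty)
  next
    fix A assume A: "A \<in> Fpow (snd ` R)"
    then show "\<rho> A \<le> f A"
      using k.f_ge[OF Dfin, of A] by (simp add: f_def D_delta Fpow_iff)
    fix B assume B: "B \<in> Fpow (snd ` R)"
    show "f (A \<union> B) \<le> f A + f B"
      using k.f_Un[OF Dfin Dfin, of A B] by (simp add: f_def D_Un)
    fix b assume b: "b \<in> snd ` R"
    \<comment> \<open>A partner \<open>c\<close> of \<open>b\<close> takes the place of
      \<open>b\<close> in \<open>f_link\<close>; monotonicity then passes from \<open>c\<close> to
      all of \<open>D {b}\<close>.\<close>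
    obtain c where c: "c \<in> D {b}" using Dne[OF b] by blast
    have "f (A \<union> B) \<le> \<delta> (insert x (insert c (D A))) + \<delta> (insert c (D B))"
      using k.f_link[OF Dfin Dfin, of c A B] c Dfin[of "{b}"] by (auto simp: f_def D_Un Fpow_iff)
    also have "\<delta> (insert x (insert c (D A))) \<le> f (insert b A)"
      unfolding f_def D_insert[of b A] using c Dfin x by (intro X.mono) (auto simp: Fpow_iff)
    also have "\<delta> (insert c (D B)) \<le> \<delta> (D (insert b B))"
      unfolding D_insert[of b B] using c Dfin by (intro X.mono) (auto simp: Fpow_iff)
    also have "\<dots> = \<rho> (insert b B)"
      using b B by (intro D_delta) (auto simp: Fpow_iff)
    finally show "f (A \<union> B) \<le> f (insert b A) + \<rho> (insert b B)" by simp
  qed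
  have "restrict f (Fpow (snd ` R)) \<in> adm_space (snd ` R) \<rho>"
    by (rule f.restrict_adm_space) simp
  then obtain y where y: "y \<in> Y" "\<And>B. B \<subseteq> snd ` R \<Longrightarrow> restrict f (Fpow (snd ` R)) B = \<rho> (insert y B)"
    using ext F unfolding extension_property_def by blast
  have fy: "f B = \<rho> (insert y B)" if "B \<subseteq> snd ` R" for B
    using y(2)[OF that] finite_subset[OF that] that R(2) by (simp add: Fpow_iff)
  have "iso_graph X \<delta> Y \<rho> (insert (x, y) R)"
    unfolding iso_graph_def
  proof (intro conjI ballI)
    show "insert (x, y) R \<subseteq> X \<times> Y" using R x y by (auto simp: iso_graph_def)
    fix Q assume Q: "Q \<in> Fpow (insert (x, y) R)"
    show "\<delta> (fst ` Q) = \<rho> (snd ` Q)"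
    proof (cases "(x, y) \<in> Q")
      case False
      then have "Q \<in> Fpow R" using Q by (auto simp: Fpow_iff)
      then show ?thesis using R by (simp add: iso_graph_def)
    next
      case True
      define P where "P = Q \<inter> R"
      have P: "P \<subseteq> R" "finite P" "Q = insert (x, y) P"
        using True Q by (auto simp: P_def Fpow_iff)
      \<comment> \<open>A priori \<open>D\<close> also collects partners outside \<open>P\<close>.
        Two partners of the same \<open>b\<close> have diversity \<open>\<rho> {b} = 0\<close>,
        hence coincide.\<close>
      have "D (snd ` P) = fst ` P"
      proof
        show "D (snd ` P) \<subseteq> fst ` P"
        proof
          fix a assume "a \<in> D (snd ` P)"
          then obtain b a' where ab: "(a, b) \<in> R" "(a', b) \<in> P" by (force simp: D_def)
          then have "{(a, b), (a', b)} \<in> Fpow R" using P by (auto simp: Fpow_iff)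
          then have "\<delta> (fst ` {(a, b), (a', b)}) = \<rho> (snd ` {(a, b), (a', b)})"
            using R(1) unfolding iso_graph_def by blast
          then have "\<delta> {a, a'} = \<rho> {b}" by simp
          moreover have "a \<in> X" "a' \<in> X" "b \<in> Y" using R(1) ab P by (auto simp: iso_graph_def)
          ultimately have "a = a'"
            using X.eq_if_zero Y.singleton by metis
          then show "a \<in> fst ` P" using ab by force
        qed
        show "fst ` P \<subseteq> D (snd ` P)" using P by (auto simp: D_def)
      qed
      then show ?thesis
        using fy[of "snd ` P"] P by (auto simp: f_def image_mono)
    qed
  qed
  then show ?thesis ..
qed

lemma iso_graph_Union:
  assumes "\<And>n. iso_graph X \<delta> Y \<rho> (S n)" "incseq S"
  shows "iso_graph X \<delta> Y \<rho> (\<Union>n. S n)"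
  unfolding iso_graph_def
proof (intro conjI ballI)
  show "(\<Union>n. S n) \<subseteq> X \<times> Y" using assms(1) unfolding iso_graph_def by blast
  fix Q assume "Q \<in> Fpow (\<Union>n. S n)"
  then obtain n where "Q \<in> Fpow (S n)"
    using finite_subset_incseq[OF _ _ assms(2), of Q] by (auto simp: Fpow_iff)
  then show "\<delta> (fst ` Q) = \<rho> (snd ` Q)" using assms(1) unfolding iso_graph_def by blast
qed

end

lemma back_and_forth:
  assumes X: "diversity X \<delta>" "extension_property X \<delta>" and Y: "diversity Y \<rho>" "extension_property Y \<rho>"
    and x: "\<And>n :: nat. x n \<in> X" and y: "\<And>n :: nat. y n \<in> Y"
  shows "\<exists>R. iso_graph X \<delta> Y \<rho> R \<and> range x \<subseteq> fst ` R \<and> range y \<subseteq> snd ` R"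
proof -
  interpret XY: diversity_pair X \<delta> Y \<rho> using X Y by (simp add: diversity_pair_def)
  interpret YX: diversity_pair Y \<rho> X \<delta> using X Y by (simp add: diversity_pair_def)
  have "\<exists>S. \<forall>n. (iso_graph X \<delta> Y \<rho> (S n) \<and> finite (S n)) \<and>
      (S n \<subseteq> S (Suc n) \<and> x n \<in> fst ` S (Suc n) \<and> y n \<in> snd ` S (Suc n))"
  proof (rule dependent_nat_choice)
    have "Fpow {} = {{} :: ('a \<times> 'b) set}" by (auto simp: Fpow_iff)
    then show "\<exists>S. iso_graph X \<delta> Y \<rho> S \<and> finite S"
      using XY.X.empty XY.Y.empty by (intro exI[of _ "{}"]) (simp add: iso_graph_def)
  next
    fix S n assume S: "iso_graph X \<delta> Y \<rho> S \<and> finite S"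
    then obtain b where b: "iso_graph X \<delta> Y \<rho> (insert (x n, b) S)"
      using XY.iso_graph_extend Y(2) x by blast
    \<comment> \<open>The back step is the forth step for the converse relation.\<close>
    then obtain a where "iso_graph Y \<rho> X \<delta> (insert (y n, a) ((insert (x n, b) S)\<inverse>))"
      using YX.iso_graph_extend[OF iso_graph_converse[OF b] _ X(2) y[of n]] S by auto
    moreover have "(insert (y n, a) ((insert (x n, b) S)\<inverse>))\<inverse> = insert (a, y n) (insert (x n, b) S)"
      by auto
    ultimately have "iso_graph X \<delta> Y \<rho> (insert (a, y n) (insert (x n, b) S))"
      using iso_graph_converse by metis
    then show "\<exists>S'. (iso_graph X \<delta> Y \<rho> S' \<and> finite S') \<and>
        (S \<subseteq> S' \<and> x n \<in> fst ` S' \<and> y n \<in> snd ` S')"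
      using S by (intro exI[of _ "insert (a, y n) (insert (x n, b) S)"]) auto
  qed
  then obtain S where S: "\<And>n. iso_graph X \<delta> Y \<rho> (S n)" "\<And>n. S n \<subseteq> S (Suc n)"
    "\<And>n. x n \<in> fst ` S (Suc n)" "\<And>n. y n \<in> snd ` S (Suc n)"
    by metis
  have "iso_graph X \<delta> Y \<rho> (\<Union>n. S n)"
    using S(1,2) by (intro XY.iso_graph_Union incseq_SucI)
  moreover have "range x \<subseteq> fst ` (\<Union>n. S n)" "range y \<subseteq> snd ` (\<Union>n. S n)"
    using S(3,4) by blast+
  ultimately show ?thesis by blast
qed

section \<open>Completion\<close>

text \<open>Continuity in the form used for limits: a diversity is 1-Lipschitz with respect to the
  sum of the displacements, even if points of the family collide.\<close>

lemma (in diversity) image_diff_le: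
  assumes "finite I" "u ` I \<subseteq> X" "v ` I \<subseteq> X"
  shows "\<bar>\<delta> (u ` I) - \<delta> (v ` I)\<bar> \<le> (\<Sum>i\<in>I. \<delta> {u i, v i})"
  using image_le[OF assms] image_le[OF assms(1,3,2)] by (simp add: insert_commute)

lemma (in Metric_space) MCauchy_close:
  assumes s: "MCauchy s" and t: "range t \<subseteq> M" and st: "(\<lambda>n. d (s n) (t n)) \<longlonglongrightarrow> 0"
  shows "MCauchy t"
  unfolding MCauchy_def
proof (intro conjI allI impI t)
  fix e :: real assume e: "0 < e"
  have sM: "s n \<in> M" for n using s by (auto simp: MCauchy_def)
  obtain N1 where N1: "\<And>n m. N1 \<le> n \<Longrightarrow> N1 \<le> m \<Longrightarrow> d (s n) (s m) < e / 3"
    using s e unfolding MCauchy_def by (meson divide_pos_pos zero_less_numeral)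
  obtain N2 where N2: "\<And>n. N2 \<le> n \<Longrightarrow> d (s n) (t n) < e / 3"
    using LIMSEQ_D[OF st, of "e / 3"] e by auto
  have "d (t n) (t m) < e" if "max N1 N2 \<le> n" "max N1 N2 \<le> m" for n m
  proof -
    have "d (t n) (t m) \<le> d (t n) (s n) + d (s n) (t m)"
      using t sM by (intro triangle) auto
    also have "d (s n) (t m) \<le> d (s n) (s m) + d (s m) (t m)"
      using t sM by (intro triangle) auto
    finally show ?thesis
      using N1[of n m] N2[of n] N2[of m] that by (simp add: commute[of "t n" "s n"])
  qed
  then show "\<exists>N. \<forall>n n'. N \<le> n \<longrightarrow> N \<le> n' \<longrightarrow> d (t n) (t n') < e" by blast
qed

lemma (in diversity) equiv_cauchy_rel:
  "equiv {s. Metric_space.MCauchy X (induced_metric X \<delta>) s} (cauchy_rel X \<delta>)"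
proof -
  interpret M: Metric_space X "induced_metric X \<delta>" by (rule Metric_space)
  show ?thesis
  proof (rule equivI)
    show "cauchy_rel X \<delta> \<subseteq> {s. M.MCauchy s} \<times> {s. M.MCauchy s}"
      by (auto simp: cauchy_rel_def)
    have "induced_metric X \<delta> (s n) (s n) = 0" if "M.MCauchy s" for s n
    proof -
      have "s n \<in> X" using that by (auto simp: M.MCauchy_def)
      then show ?thesis by simp
    qed
    then show "refl_on {s. M.MCauchy s} (cauchy_rel X \<delta>)"
      by (auto simp: refl_on_def cauchy_rel_def)
    show "sym (cauchy_rel X \<delta>)"
      by (auto simp: sym_def cauchy_rel_def M.commute)
    show "trans (cauchy_rel X \<delta>)"
    proof (rule transI)
      fix s t u assume "(s, t) \<in> cauchy_rel X \<delta>" "(t, u) \<in> cauchy_rel X \<delta>"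
      then have C: "M.MCauchy s" "M.MCauchy t" "M.MCauchy u"
        and lim: "(\<lambda>n. induced_metric X \<delta> (s n) (t n)) \<longlonglongrightarrow> 0" "(\<lambda>n. induced_metric X \<delta> (t n) (u n)) \<longlonglongrightarrow> 0"
        by (auto simp: cauchy_rel_def)
      have "(\<lambda>n. induced_metric X \<delta> (s n) (u n)) \<longlonglongrightarrow> 0"
      proof (rule Lim_null_comparison)
        show "(\<lambda>n. induced_metric X \<delta> (s n) (t n) + induced_metric X \<delta> (t n) (u n)) \<longlonglongrightarrow> 0"
          using tendsto_add[OF lim] by simp
        have "induced_metric X \<delta> (s n) (u n) \<le> induced_metric X \<delta> (s n) (t n) + induced_metric X \<delta> (t n) (u n)" for n
          using C by (intro M.triangle) (auto simp: M.MCauchy_def)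
        then show "\<forall>\<^sub>F n in sequentially. norm (induced_metric X \<delta> (s n) (u n))
            \<le> induced_metric X \<delta> (s n) (t n) + induced_metric X \<delta> (t n) (u n)"
          by simp
      qed
      then show "(s, u) \<in> cauchy_rel X \<delta>" using C by (simp add: cauchy_rel_def)
    qed
  qed
qed

text \<open>A point \<open>x\<close> goes to the class of the \<open>Y\<close>-partners of a
  sequence in \<open>R\<close> tending to \<open>x\<close>. Completeness of \<open>X\<close> gives
  surjectivity: a Cauchy sequence of \<open>Y\<close>, approximated through \<open>R\<close> and
  carried over to \<open>X\<close>, has a limit there.\<close>

lemma isomorphic_completion:
  assumes X: "complete_diversity X \<delta>" and Y: "diversity Y \<rho>"
    and R: "iso_graph X \<delta> Y \<rho> R"
    and denseX: "\<And>x e. x \<in> X \<Longrightarrow> 0 < e \<Longrightarrow> \<exists>p\<in>R. \<delta> {x, fst p} < e"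
    and denseY: "\<And>y e. y \<in> Y \<Longrightarrow> 0 < e \<Longrightarrow> \<exists>p\<in>R. \<rho> {y, snd p} < e"
  shows "isomorphic_diversities X \<delta> (completion_carrier Y \<rho>) (completion_delta \<rho>)"
proof -
  interpret diversity_pair X \<delta> Y \<rho> using X Y by (simp add: diversity_pair_def complete_diversity_def)
  let ?d = "induced_metric X \<delta>" and ?e = "induced_metric Y \<rho>"
  interpret MX: Metric_space X ?d by (rule X.Metric_space)
  interpret MY: Metric_space Y ?e by (rule Y.Metric_space)
  have RX: "fst p \<in> X" and RY: "snd p \<in> Y" if "p \<in> R" for p
    using R that by (auto simp: iso_graph_def)
  have R_dist: "?e (snd p) (snd q) = ?d (fst p) (fst q)" if "p \<in> R" "q \<in> R" for p q
  proof -
    have "{p, q} \<in> Fpow R" using that by (simp add: Fpow_iff)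
    then have "\<delta> (fst ` {p, q}) = \<rho> (snd ` {p, q})" using R unfolding iso_graph_def by blast
    then show ?thesis using that RX RY by (simp add: induced_metric_def)
  qed
  have R_Cauchy: "MY.MCauchy (\<lambda>n. snd (p n)) \<longleftrightarrow> MX.MCauchy (\<lambda>n. fst (p n))" if "\<And>n. p n \<in> R" for p
    unfolding MX.MCauchy_def MY.MCauchy_def image_subset_iff
    using RX[OF that] RY[OF that] R_dist[OF that that] by simp
  have lim_inverse: "s \<longlonglongrightarrow> 0" if "\<And>n. 0 \<le> s n" "\<And>n. s n < inverse (real (Suc n))" for s :: "nat \<Rightarrow> real"
  proof (rule Lim_null_comparison[OF _ LIMSEQ_inverse_real_of_nat])
    have "norm (s n) \<le> inverse (real (Suc n))" for n
      using that[of n] by (simp only: real_norm_def abs_of_nonneg less_imp_le)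
    then show "\<forall>\<^sub>F n in sequentially. norm (s n) \<le> inverse (real (Suc n))" by simp
  qed

  have "\<exists>p. (\<forall>n. p n \<in> R) \<and> (\<lambda>n. ?d x (fst (p n))) \<longlonglongrightarrow> 0" if "x \<in> X" for x
  proof -
    have "\<exists>p\<in>R. \<delta> {x, fst p} < inverse (real (Suc n))" for n using denseX that by simp
    then obtain p where "\<And>n. p n \<in> R" "\<And>n. \<delta> {x, fst (p n)} < inverse (real (Suc n))" by metis
    then show ?thesis
      using that RX by (intro exI[of _ p] conjI allI lim_inverse) (simp_all add: X.induced_metric_eq X.nonneg Fpow_iff)
  qed
  then obtain p where p: "\<And>x n. x \<in> X \<Longrightarrow> p x n \<in> R" "\<And>x. x \<in> X \<Longrightarrow> (\<lambda>n. ?d x (fst (p x n))) \<longlonglongrightarrow> 0"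
    by metis
  have p_Cauchy: "MY.MCauchy (\<lambda>n. snd (p x n))" if x: "x \<in> X" for x
  proof -
    have "MX.MCauchy (\<lambda>n. fst (p x n))"
      by (rule MX.MCauchy_close[of "\<lambda>_. x"])
        (use p(2)[OF x] RX[OF p(1)[OF x]] x in \<open>simp_all add: image_subset_iff\<close>)
    then show ?thesis using R_Cauchy[of "p x"] p(1)[OF x] by simp
  qed

  define \<Phi> where "\<Phi> x = cauchy_rel Y \<rho> `` {\<lambda>n. snd (p x n)}" for x
  have \<Phi>_lim: "(\<lambda>n. \<rho> ((\<lambda>C. (SOME s. s \<in> C) n) ` \<Phi> ` A)) \<longlonglongrightarrow> \<delta> A" if A: "A \<in> Fpow X" for A
  proof -
    \<comment> \<open>\<open>completion_delta\<close> evaluates at representatives picked by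
      \<open>SOME\<close>, not at the approximants \<open>p x\<close>. The estimate therefore goes
      from \<open>s x n\<close> to \<open>snd (p x n)\<close>, crosses along \<open>R\<close> to
      \<open>fst (p x n)\<close>, and ends at \<open>x\<close>.\<close>
    define s where "s x = (SOME s. s \<in> \<Phi> x)" for x
    have AX: "finite A" "A \<subseteq> X" using A by (auto simp: Fpow_iff)
    have "(\<lambda>n. snd (p x n), s x) \<in> cauchy_rel Y \<rho>" if "x \<in> X" for x
    proof -
      have "(\<lambda>n. snd (p x n)) \<in> \<Phi> x"
        using equiv_class_self[OF Y.equiv_cauchy_rel] p_Cauchy[OF that] by (simp add: \<Phi>_def)
      then have "s x \<in> \<Phi> x" unfolding s_def by (rule someI[of "\<lambda>s. s \<in> \<Phi> x"])
      then show ?thesis by (simp add: \<Phi>_def)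
    qed
    then have sY: "\<And>x n. x \<in> X \<Longrightarrow> s x n \<in> Y" and slim: "\<And>x. x \<in> X \<Longrightarrow> (\<lambda>n. ?e (snd (p x n)) (s x n)) \<longlonglongrightarrow> 0"
      by (simp_all add: cauchy_rel_def MY.MCauchy_def image_subset_iff)
    have "(\<lambda>n. \<rho> ((\<lambda>x. s x n) ` A) - \<delta> A) \<longlonglongrightarrow> 0"
    proof (rule Lim_null_comparison)
      have "(\<lambda>n. \<Sum>x\<in>A. ?e (snd (p x n)) (s x n) + ?d x (fst (p x n))) \<longlonglongrightarrow> (\<Sum>x\<in>A. 0 + 0)"
        using slim p(2) AX by (intro tendsto_sum tendsto_add) auto
      then show "(\<lambda>n. \<Sum>x\<in>A. ?e (snd (p x n)) (s x n) + ?d x (fst (p x n))) \<longlonglongrightarrow> 0" by simp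
      have "\<bar>\<rho> ((\<lambda>x. s x n) ` A) - \<delta> A\<bar> \<le> (\<Sum>x\<in>A. ?e (snd (p x n)) (s x n) + ?d x (fst (p x n)))" for n
      proof -
        have "(\<lambda>x. p x n) ` A \<in> Fpow R" using AX p(1) by (auto simp: Fpow_iff)
        then have "\<delta> (fst ` (\<lambda>x. p x n) ` A) = \<rho> (snd ` (\<lambda>x. p x n) ` A)"
          using R by (simp add: iso_graph_def)
        then have eq: "\<delta> ((\<lambda>x. fst (p x n)) ` A) = \<rho> ((\<lambda>x. snd (p x n)) ` A)"
          by (simp add: image_image)
        have "\<bar>\<rho> ((\<lambda>x. snd (p x n)) ` A) - \<rho> ((\<lambda>x. s x n) ` A)\<bar> \<le> (\<Sum>x\<in>A. \<rho> {snd (p x n), s x n})"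
          using AX sY RY[OF p(1)] by (intro Y.image_diff_le) auto
        also have "\<dots> = (\<Sum>x\<in>A. ?e (snd (p x n)) (s x n))"
          using AX sY RY[OF p(1)] by (intro sum.cong) (auto simp: subset_iff induced_metric_def)
        finally have 1: "\<bar>\<rho> ((\<lambda>x. snd (p x n)) ` A) - \<rho> ((\<lambda>x. s x n) ` A)\<bar> \<le> \<dots>" .
        have "\<bar>\<delta> ((\<lambda>x. x) ` A) - \<delta> ((\<lambda>x. fst (p x n)) ` A)\<bar> \<le> (\<Sum>x\<in>A. \<delta> {x, fst (p x n)})"
          using AX RX[OF p(1)] by (intro X.image_diff_le) auto
        also have "\<dots> = (\<Sum>x\<in>A. ?d x (fst (p x n)))"
          using AX RX[OF p(1)] by (intro sum.cong) (auto simp: induced_metric_def)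
        finally show ?thesis using 1 eq by (simp add: sum.distrib)
      qed
      then show "\<forall>\<^sub>F n in sequentially. norm (\<rho> ((\<lambda>x. s x n) ` A) - \<delta> A)
          \<le> (\<Sum>x\<in>A. ?e (snd (p x n)) (s x n) + ?d x (fst (p x n)))"
        by simp
    qed
    then have "(\<lambda>n. \<rho> ((\<lambda>x. s x n) ` A)) \<longlonglongrightarrow> \<delta> A" by (simp add: LIM_zero_iff)
    then show ?thesis by (simp add: s_def image_image)
  qed
  then have \<Phi>_delta: "completion_delta \<rho> (\<Phi> ` A) = \<delta> A" if "A \<in> Fpow X" for A
    unfolding completion_delta_def using that by (intro limI)
  have "inj_on \<Phi> X"
  proof (rule inj_onI)
    fix x y assume xy: "x \<in> X" "y \<in> X" "\<Phi> x = \<Phi> y"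
    \<comment> \<open>Both sides are the value of \<open>completion_delta\<close> at the same single
      class.\<close>
    then have "\<delta> {x, y} = \<delta> {x}"
      using \<Phi>_delta[of "{x, y}"] \<Phi>_delta[of "{x}"] by (simp add: Fpow_iff)
    then show "x = y"
      using xy X.eq_if_zero X.singleton by metis
  qed
  moreover have "\<Phi> ` X = completion_carrier Y \<rho>"
  proof
    show "\<Phi> ` X \<subseteq> completion_carrier Y \<rho>"
      using p_Cauchy by (auto simp: \<Phi>_def completion_carrier_def intro: quotientI)
    show "completion_carrier Y \<rho> \<subseteq> \<Phi> ` X"
    proof
      fix C assume "C \<in> completion_carrier Y \<rho>"
      then obtain t where t: "MY.MCauchy t" "C = cauchy_rel Y \<rho> `` {t}"
        by (auto simp: completion_carrier_def elim: quotientE)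
      have tY: "t n \<in> Y" for n using t by (auto simp: MY.MCauchy_def)
      have "\<exists>q\<in>R. \<rho> {t n, snd q} < inverse (real (Suc n))" for n using denseY tY by simp
      then obtain q where q: "\<And>n. q n \<in> R" "\<And>n. \<rho> {t n, snd (q n)} < inverse (real (Suc n))" by metis
      have lim: "(\<lambda>n. ?e (t n) (snd (q n))) \<longlonglongrightarrow> 0"
        using q tY RY by (intro lim_inverse) (simp_all add: Y.induced_metric_eq Y.nonneg Fpow_iff)
      then have "MY.MCauchy (\<lambda>n. snd (q n))"
        using RY[OF q(1)] by (intro MY.MCauchy_close[OF t(1)]) (simp_all add: image_subset_iff)
      moreover from this have "MX.MCauchy (\<lambda>n. fst (q n))"
        using R_Cauchy[of q] q(1) by simp
      then obtain x where "limitin MX.mtopology (\<lambda>n. fst (q n)) x sequentially"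
        using X by (auto simp: complete_diversity_def MX.mcomplete_def)
      then have x: "x \<in> X" "(\<lambda>n. ?d (fst (q n)) x) \<longlonglongrightarrow> 0"
        by (auto simp: MX.limitin_metric_dist_null)
      \<comment> \<open>On the side of \<open>X\<close> both \<open>q\<close> and \<open>p x\<close>
        tend to \<open>x\<close>, and distances along \<open>R\<close> are the same on the side of
        \<open>Y\<close>.\<close>
      have "(\<lambda>n. ?e (snd (q n)) (snd (p x n))) \<longlonglongrightarrow> 0"
      proof (rule Lim_null_comparison)
        show "(\<lambda>n. ?d (fst (q n)) x + ?d x (fst (p x n))) \<longlonglongrightarrow> 0"
          using tendsto_add[OF x(2) p(2)[OF x(1)]] by simp
        have "?d (fst (q n)) (fst (p x n)) \<le> ?d (fst (q n)) x + ?d x (fst (p x n))" for n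
          using x RX[OF p(1)] RX[OF q(1)] by (intro MX.triangle) auto
        then show "\<forall>\<^sub>F n in sequentially. norm (?e (snd (q n)) (snd (p x n)))
            \<le> ?d (fst (q n)) x + ?d x (fst (p x n))"
          using R_dist q(1) p(1)[OF x(1)] by simp
      qed
      then have "(\<lambda>n. snd (q n), \<lambda>n. snd (p x n)) \<in> cauchy_rel Y \<rho>"
        using p_Cauchy[OF x(1)] calculation by (simp add: cauchy_rel_def)
      moreover have "(t, \<lambda>n. snd (q n)) \<in> cauchy_rel Y \<rho>"
        using t(1) calculation lim by (simp add: cauchy_rel_def)
      ultimately have "(t, \<lambda>n. snd (p x n)) \<in> cauchy_rel Y \<rho>"
        using Y.equiv_cauchy_rel by (meson equivE transE)
      then have "C = \<Phi> x"
        unfolding t(2) \<Phi>_def by (rule equiv_class_eq[OF Y.equiv_cauchy_rel])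
      then show "C \<in> \<Phi> ` X" using x(1) by blast
    qed
  qed
  ultimately have "diversity_iso X \<delta> (completion_carrier Y \<rho>) (completion_delta \<rho>) \<Phi>"
    using \<Phi>_delta by (simp add: diversity_iso_def bij_betw_def)
  then show ?thesis by (auto simp: isomorphic_diversities_def)
qed

section \<open>The universal ultrahomogeneous diversity\<close>

lemma ultrahomogeneous_universal_imp_extension_property:
  assumes hom: "ultrahomogeneous_diversity X \<delta>" and univ: "universal_diversity X \<delta>"
  shows "extension_property X \<delta>"
  unfolding extension_property_def
proof (intro ballI)
  fix F f assume F: "F \<in> Fpow X" and "f \<in> adm_space F \<delta>"
  then obtain z :: "'a option" and \<delta>' where Z: "diversity (insert z (Some ` F)) \<delta>'"
    and d: "\<And>A. A \<in> Fpow F \<Longrightarrow> \<delta>' (Some ` A) = \<delta> A"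
    and f: "\<And>A. A \<in> Fpow F \<Longrightarrow> \<delta>' (insert z (Some ` A)) = f A"
    unfolding adm_space_def adm_fun_def by blast
  let ?Z = "insert z (Some ` F)"
  interpret Z: diversity ?Z \<delta>' by fact
  have "countable ?Z" using F by (auto simp: Fpow_iff intro: countable_finite)
  moreover have "\<forall>x\<in>?Z. \<forall>e>0. \<exists>c\<in>?Z. \<delta>' {x, c} < e"
  proof (intro ballI allI impI)
    fix x and e :: real assume "x \<in> ?Z" "0 < e"
    then show "\<exists>c\<in>?Z. \<delta>' {x, c} < e" using Z.singleton[of x] by (intro bexI[of _ x]) simp_all
  qed
  ultimately have "separable_diversity ?Z \<delta>'"
    unfolding Z.separable_diversity_iff by blast
  then obtain W \<phi> where W: "W \<subseteq> X" and \<phi>: "bij_betw \<phi> ?Z W"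
    and \<phi>d: "\<And>A. A \<in> Fpow ?Z \<Longrightarrow> \<delta> (\<phi> ` A) = \<delta>' A"
    using universal_diversity_any_type[OF univ] unfolding isomorphic_diversities_def diversity_iso_def
    by metis
  define g where "g = \<phi> \<circ> Some"
  have g: "inj_on g F" "g ` F \<subseteq> X"
    using \<phi> W by (auto simp: g_def bij_betw_def intro!: comp_inj_on intro: inj_on_subset)
  have gd: "\<delta> (g ` A) = \<delta> A" if "A \<in> Fpow F" for A
  proof -
    have "Some ` A \<in> Fpow ?Z" using that by (auto simp: Fpow_iff)
    then show ?thesis using \<phi>d d[OF that] unfolding g_def image_comp[symmetric] by simp
  qed
  \<comment> \<open>It is the inverse of \<open>g\<close> that is extended to \<open>X\<close>: the
    extension \<open>\<psi>\<close> carries the copy of \<open>F\<close> back onto \<open>F\<close>,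
    and \<open>\<psi> (\<phi> z)\<close> is the point sought.\<close>
  have "diversity_iso (g ` F) \<delta> F \<delta> (inv_into F g)"
    unfolding diversity_iso_def
  proof (intro conjI ballI)
    show "bij_betw (inv_into F g) (g ` F) F"
      using g by (intro bij_betw_inv_into) (simp add: bij_betw_def)
    fix B assume "B \<in> Fpow (g ` F)"
    then obtain A where "A \<in> Fpow F" "B = g ` A"
      by (auto simp: Fpow_iff dest: finite_subset_image)
    then show "\<delta> (inv_into F g ` B) = \<delta> B"
      using gd g by (simp add: inv_into_image_cancel Fpow_iff)
  qed
  moreover have "g ` F \<in> Fpow X" using F g by (auto simp: Fpow_iff)
  ultimately obtain \<psi> where \<psi>: "diversity_iso X \<delta> X \<delta> \<psi>" "\<And>b. b \<in> g ` F \<Longrightarrow> \<psi> b = inv_into F g b"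
    using hom F unfolding ultrahomogeneous_diversity_def by metis
  have \<psi>g: "\<psi> (g a) = a" if "a \<in> F" for a using \<psi>(2) that g by simp
  have z: "\<phi> z \<in> X" using \<phi> W by (auto simp: bij_betw_def)
  have "f A = \<delta> (insert (\<psi> (\<phi> z)) A)" if "A \<subseteq> F" for A
  proof -
    have A: "A \<in> Fpow F" using that F by (auto simp: Fpow_iff intro: finite_subset)
    have "f A = \<delta> (\<phi> ` insert z (Some ` A))"
      using f[OF A] A by (subst \<phi>d) (auto simp: Fpow_iff)
    also have "\<dots> = \<delta> (insert (\<phi> z) (g ` A))" by (simp add: g_def image_comp)
    also have "\<dots> = \<delta> (\<psi> ` insert (\<phi> z) (g ` A))"
    proof -
      have "insert (\<phi> z) (g ` A) \<in> Fpow X" using z g A that by (auto simp: Fpow_iff)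
      then show ?thesis using \<psi>(1) unfolding diversity_iso_def by metis
    qed
    also have "\<psi> ` insert (\<phi> z) (g ` A) = insert (\<psi> (\<phi> z)) A"
      using \<psi>g that by (force simp: image_image)
    finally show ?thesis .
  qed
  moreover have "\<psi> (\<phi> z) \<in> X" using \<psi>(1) z by (auto simp: diversity_iso_def bij_betw_def)
  ultimately show "\<exists>x\<in>X. \<forall>A\<subseteq>F. f A = \<delta> (insert x A)" by blast
qed

lemma polish_extension_property_imp_isomorphic_UU:
  fixes X :: "'a set"
  assumes X: "polish_diversity X \<delta>" and ext: "extension_property X \<delta>"
  shows "isomorphic_diversities X \<delta> UU delta_UU"
proof -
  have sep: "separable_diversity X \<delta>" and compl: "complete_diversity X \<delta>"
    using X by (auto simp: polish_diversity_def)
  interpret X: diversity X \<delta> using sep by (simp add: separable_diversity_def)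
  interpret T: diversity tower_union tower_union_delta by (rule diversity_tower_union)
  obtain C where C: "countable C" "C \<subseteq> X" "\<And>x e. x \<in> X \<Longrightarrow> 0 < e \<Longrightarrow> \<exists>c\<in>C. \<delta> {x, c} < e"
    using sep unfolding X.separable_diversity_iff by blast
  obtain D where D: "countable D" "D \<subseteq> tower_union"
    "\<And>x e. x \<in> tower_union \<Longrightarrow> 0 < e \<Longrightarrow> \<exists>c\<in>D. tower_union_delta {x, c} < e"
    using separable_tower_union unfolding T.separable_diversity_iff by blast
  \<comment> \<open>Enumerating the dense sets by \<open>from_nat_into\<close> requires them to be
    nonempty. That \<open>X\<close> has a point is its extension property for the empty set, on
    which the zero function is admissible.\<close>
  have ne: "X \<noteq> {}" "tower_union \<noteq> {}"
  proof -
    have E: "restrict (\<lambda>_. 0) (Fpow {}) \<in> adm_space {} \<delta>"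
    proof -
      interpret E: diversity "{}" \<delta> by (rule X.subset) simp
      have "admissible {} \<delta> (\<lambda>_. 0)"
        using E.empty by unfold_locales (auto simp: Fpow_iff)
      then show ?thesis by (rule admissible.restrict_adm_space) simp
    qed
    have "{} \<in> Fpow X" by (simp add: Fpow_iff)
    then show "X \<noteq> {}" using ext E unfolding extension_property_def by blast
    show "tower_union \<noteq> {}"
      using tower_union_subset[of 0] by auto
  qed
  have CD: "C \<noteq> {}" "D \<noteq> {}" using ne C(3) D(3) by (meson equals0I ex_in_conv zero_less_one)+
  have "\<And>n. from_nat_into C n \<in> X" "\<And>n. from_nat_into D n \<in> tower_union"
    using C(2) D(2) CD by (meson from_nat_into subsetD)+
  then obtain R where R: "iso_graph X \<delta> tower_union tower_union_delta R"
    "range (from_nat_into C) \<subseteq> fst ` R" "range (from_nat_into D) \<subseteq> snd ` R"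
    using back_and_forth[OF X.diversity_axioms ext T.diversity_axioms extension_property_tower_union,
        of "from_nat_into C" "from_nat_into D"] by blast
  show ?thesis
    unfolding UU_def delta_UU_def
  proof (rule isomorphic_completion[OF compl T.diversity_axioms R(1)])
    fix x and e :: real assume "x \<in> X" "0 < e"
    then obtain c where "c \<in> C" "\<delta> {x, c} < e" using C(3) by blast
    moreover have "c \<in> fst ` R" using R(2) C(1) CD \<open>c \<in> C\<close> by (metis range_from_nat_into subsetD)
    ultimately show "\<exists>p\<in>R. \<delta> {x, fst p} < e" by auto
  next
    fix y and e :: real assume "y \<in> tower_union" "0 < e"
    then obtain c where "c \<in> D" "tower_union_delta {y, c} < e" using D(3) by blast
    moreover have "c \<in> snd ` R" using R(3) D(1) CD \<open>c \<in> D\<close> by (metis range_from_nat_into subsetD)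
    ultimately show "\<exists>p\<in>R. tower_union_delta {y, snd p} < e" by auto
  qed
qed

theorem theorem22:
  fixes X :: "'a set" and \<delta> :: "'a set \<Rightarrow> real"
  assumes "polish_diversity X \<delta>"
    and "ultrahomogeneous_diversity X \<delta>"
    and "universal_diversity X \<delta>"
  shows "extension_property X \<delta> \<and> isomorphic_diversities X \<delta> UU delta_UU"
  using ultrahomogeneous_universal_imp_extension_property[OF assms(2,3)]
    polish_extension_property_imp_isomorphic_UU[OF assms(1)] by blast

end
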